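(* Assume the Continuum Hypothesis. Then there is a crowded, zero-dimensional Hausdorff topological space $X$ with $|X|=w(X)=\omega_1$ such that every countably infinite discrete subset of $X$ is closed in $X$, and $X$ is $Nwd_\omega(X)$-selectively pseudocompact, where $Nwd_\omega(X)$ is the family of countably infinite nowhere dense subsets of $X$.
   Context: For a topological space $X$ and $\mathcal A\subseteq\mathcal P(X)$, $X$ is called $\mathcal A$-selectively pseudocompact if for every sequence $\langle U_n:n\in\omega\rangle$ of pairwise disjoint non-empty open subsets of $X$ one can choose sets $A_n\in\mathcal A$ with $A_n\subseteq U_n$ such that the family $\{A_n:n\in\omega\}$ has an accumulation point, i.e. there is a point $x\in X$ every neighbourhood of which meets $A_n$ for infinitely many $n$. A space is crowded if it has no isolated points; $w(X)$ is the weight of $X$. *)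

theory Defs
  imports "HOL-Analysis.Analysis"
begin

unbundle cardinal_syntax

definition CH :: bool where
  "CH \<longleftrightarrow> card_of (UNIV :: real set) =o cardSuc natLeq"

definition base_of :: "'a topology \<Rightarrow> 'a set set \<Rightarrow> bool" where
  "base_of X B \<longleftrightarrow> openin X = arbitrary union_of (\<lambda>V. V \<in> B)"

definition weight_eq :: "'a topology \<Rightarrow> 'b rel \<Rightarrow> bool" where
  "weight_eq X \<kappa> \<longleftrightarrow>
     (\<exists>B. base_of X B \<and> card_of B =o \<kappa>) \<and> (\<forall>B. base_of X B \<longrightarrow> \<kappa> \<le>o card_of B)"

definition crowded :: "'a topology \<Rightarrow> bool" where
  "crowded X \<longleftrightarrow> (\<forall>x\<in>topspace X. \<not> openin X {x})"

definition discrete_subset :: "'a topology \<Rightarrow> 'a set \<Rightarrow> bool" where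
  "discrete_subset X D \<longleftrightarrow> D \<subseteq> topspace X \<and>
     (\<forall>x\<in>D. \<exists>U. openin X U \<and> U \<inter> D = {x})"

definition nowhere_dense :: "'a topology \<Rightarrow> 'a set \<Rightarrow> bool" where
  "nowhere_dense X A \<longleftrightarrow> A \<subseteq> topspace X \<and> X interior_of (X closure_of A) = {}"

definition Nwd_omega :: "'a topology \<Rightarrow> 'a set set" where
  "Nwd_omega X = {A. nowhere_dense X A \<and> countable A \<and> infinite A}"

definition selectively_pseudocompact :: "'a set set \<Rightarrow> 'a topology \<Rightarrow> bool" where
  "selectively_pseudocompact \<A> X \<longleftrightarrow>
     (\<forall>U :: nat \<Rightarrow> 'a set.
        (\<forall>n. openin X (U n) \<and> U n \<noteq> {}) \<and> pairwise (\<lambda>m n. disjnt (U m) (U n)) UNIV \<longrightarrow>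
        (\<exists>A :: nat \<Rightarrow> 'a set. (\<forall>n. A n \<in> \<A> \<and> A n \<subseteq> U n) \<and>
           (\<exists>x\<in>topspace X. \<forall>V. openin X V \<and> x \<in> V \<longrightarrow> infinite {n. A n \<inter> V \<noteq> {}})))"

end

theory Submission
  imports Defs "HOL-Library.Countable_Set_Type"
begin

text \<open>
  The points of the space are 0-1 functions on a set of coordinates, and the topology is that of
  pointwise convergence. Countable approximations to it carry two kinds of promises: certain
  countable sets stay crowded, and certain countable sets stay closed and discrete. Unions of
  countable chains of approximations are approximations again, so that under CH a chain of length
  \<open>\<omega>\<^sub>1\<close> settles all countable sets and all sequences of basic open sets.

  A discrete set \<open>D\<close> is made closed by declaring a union of small neighbourhoods of its
  points clopen. For disjoint basic open sets \<open>U\<^sub>n\<close>, let \<open>T\<close> be a crowded set whose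
  nowhere density is itself guaranteed by crowded sets. Choose basic clopen \<open>V\<^sub>n \<subseteq> U\<^sub>n\<close>
  meeting \<open>T\<close> such that \<open>V\<^sub>n\<close> misses the first \<open>n\<close> promised closed discrete sets and
  decides the first \<open>n\<close> coordinates, and add a point \<open>z\<close> at which the \<open>V\<^sub>n\<close>
  accumulate. Promising that \<open>{z} \<union> (\<Union>n. T \<inter> V\<^sub>n)\<close> stays crowded keeps \<open>z\<close> an
  accumulation point of the nowhere dense sets \<open>T \<inter> V\<^sub>n\<close>.
\<close>

section \<open>Approximations\<close>

text \<open>The two kinds of promise are endangered by different moves. A new coordinate refines the
  topology and may isolate a point of a set promised to be crowded, but it cannot harm a closed
  discrete set. A new point leaves old crowded sets intact, but it may be a limit of a set promised
  to be closed discrete. Each construction therefore has its own delicate half. Nowhere density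
  cannot be promised directly: a refinement may turn a nowhere dense set into an open one. It is
  replaced by crowded witnesses, which can be promised. CH provides a well-order of the reals with
  countable proper initial segments, so that reals serve as points, coordinates, stages and codes of
  tasks, and each stage extends a countable approximation only. Uncountable weight then comes for
  free: a countable local base at a point of a crowded Hausdorff space yields a sequence converging
  to that point, whose range is an infinite discrete set that is not closed.\<close>

text \<open>
  Members of \<open>crw p\<close> and \<open>cdd p\<close> are promised to stay crowded, respectively closed discrete;
  \<open>val p\<close> is meaningful on \<open>pts p \<times> crd p\<close> only.
\<close>

datatype ('a, 'b) cond =
  Cond (pts: "'a set") (crd: "'b set") (val: "'a \<Rightarrow> 'b \<Rightarrow> bool") (crw: "'a set set") (cdd: "'a set set")

definition nbhd :: "('a, 'b) cond \<Rightarrow> 'b set \<Rightarrow> 'a \<Rightarrow> 'a set" where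
  "nbhd p F x = {y \<in> pts p. \<forall>i\<in>F. val p y i = val p x i}"

definition crowded_in :: "('a, 'b) cond \<Rightarrow> 'a set \<Rightarrow> bool" where
  "crowded_in p S \<longleftrightarrow> S \<subseteq> pts p \<and> (\<forall>x\<in>S. \<forall>F\<in>Fpow (crd p). \<exists>y\<in>S. y \<noteq> x \<and> y \<in> nbhd p F x)"

text \<open>That no point of the space is an accumulation point of \<open>D\<close> expresses
  closedness and discreteness at once. In \<open>discrete_in\<close> the same condition is imposed
  at the points of \<open>D\<close> only.\<close>

definition closed_discrete_in :: "('a, 'b) cond \<Rightarrow> 'a set \<Rightarrow> bool" where
  "closed_discrete_in p D \<longleftrightarrow> D \<subseteq> pts p \<and> (\<forall>x\<in>pts p. \<exists>F\<in>Fpow (crd p). D \<inter> nbhd p F x \<subseteq> {x})"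

definition discrete_in :: "('a, 'b) cond \<Rightarrow> 'a set \<Rightarrow> bool" where
  "discrete_in p D \<longleftrightarrow> D \<subseteq> pts p \<and> (\<forall>x\<in>D. \<exists>F\<in>Fpow (crd p). D \<inter> nbhd p F x \<subseteq> {x})"

text \<open>One finite \<open>G\<close> serves all points, so \<open>V\<close> depends on finitely
  many coordinates. This is stronger than being clopen and is inherited by finite unions, not by
  infinite ones.\<close>

definition clopen_in :: "('a, 'b) cond \<Rightarrow> 'a set \<Rightarrow> bool" where
  "clopen_in p V \<longleftrightarrow> V \<subseteq> pts p \<and> (\<exists>G\<in>Fpow (crd p). \<forall>x\<in>pts p. \<forall>y\<in>nbhd p G x. y \<in> V \<longleftrightarrow> x \<in> V)"

definition separated :: "('a, 'b) cond \<Rightarrow> bool" where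
  "separated p \<longleftrightarrow> (\<forall>x\<in>pts p. \<forall>y\<in>pts p. x \<noteq> y \<longrightarrow> (\<exists>i\<in>crd p. val p x i \<noteq> val p y i))"

definition consistent :: "('a, 'b) cond \<Rightarrow> bool" where
  "consistent p \<longleftrightarrow> pts p \<noteq> {} \<and> separated p \<and>
     (\<forall>S\<in>insert (pts p) (crw p). crowded_in p S) \<and> (\<forall>D\<in>cdd p. closed_discrete_in p D)"

definition small :: "('a, 'b) cond \<Rightarrow> bool" where
  "small p \<longleftrightarrow> countable (pts p) \<and> countable (crd p) \<and> countable (crw p) \<and> countable (cdd p)"

definition ext :: "('a, 'b) cond \<Rightarrow> ('a, 'b) cond \<Rightarrow> bool"  (infix \<open>\<unlhd>\<close> 50) where
  "p \<unlhd> q \<longleftrightarrow> pts p \<subseteq> pts q \<and> crd p \<subseteq> crd q \<and> (\<forall>x\<in>pts p. \<forall>i\<in>crd p. val q x i = val p x i) \<and>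
     crw p \<subseteq> crw q \<and> cdd p \<subseteq> cdd q"

lemma ext_refl: "p \<unlhd> p"
  by (simp add: ext_def)

lemma ext_trans [trans]: "p \<unlhd> q \<Longrightarrow> q \<unlhd> r \<Longrightarrow> p \<unlhd> r"
  unfolding ext_def by (metis subset_iff)

text \<open>Old basic sets may gain new points but keep their trace on the old ones. Whatever is
  phrased through such traces survives every extension; all persistence arguments rest on
  this.\<close>

lemma nbhd_ext:
  assumes "p \<unlhd> q" "F \<subseteq> crd p" "x \<in> pts p"
  shows "nbhd q F x \<inter> pts p = nbhd p F x"
  using assms unfolding ext_def nbhd_def by (auto simp: subset_iff)

lemma nbhd_self: "x \<in> pts p \<Longrightarrow> x \<in> nbhd p F x"
  by (simp add: nbhd_def)

lemma nbhd_subset_pts: "nbhd p F x \<subseteq> pts p"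
  by (auto simp: nbhd_def)

lemma nbhd_antimono: "F \<subseteq> G \<Longrightarrow> nbhd p G x \<subseteq> nbhd p F x"
  by (auto simp: nbhd_def)

lemma nbhd_trans: "y \<in> nbhd p F x \<Longrightarrow> nbhd p F y = nbhd p F x"
  by (auto simp: nbhd_def)

lemma nbhd_Un: "nbhd p (F \<union> G) x = nbhd p F x \<inter> nbhd p G x"
  by (auto simp: nbhd_def)

lemma Fpow_Un: "F \<in> Fpow A \<Longrightarrow> G \<in> Fpow A \<Longrightarrow> F \<union> G \<in> Fpow A"
  by (simp add: Fpow_def)

lemma crowded_inD:
  assumes "crowded_in p S" "x \<in> S" "F \<in> Fpow (crd p)"
  obtains y where "y \<in> S" "y \<noteq> x" "y \<in> nbhd p F x"
  using assms unfolding crowded_in_def by blast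

lemma crowded_in_Union: "(\<And>S. S \<in> \<S> \<Longrightarrow> crowded_in p S) \<Longrightarrow> crowded_in p (\<Union>\<S>)"
  unfolding crowded_in_def by (meson Union_iff Union_least)

lemma crowded_in_Int_clopen:
  assumes "crowded_in p S" "clopen_in p V"
  shows "crowded_in p (S \<inter> V)"
proof -
  obtain G where G: "G \<in> Fpow (crd p)" "\<And>x y. x \<in> pts p \<Longrightarrow> y \<in> nbhd p G x \<Longrightarrow> y \<in> V \<longleftrightarrow> x \<in> V"
    using assms(2) unfolding clopen_in_def by blast
  have "\<exists>y\<in>S \<inter> V. y \<noteq> x \<and> y \<in> nbhd p F x" if x: "x \<in> S" "x \<in> V" "F \<in> Fpow (crd p)" for x F
  proof -
    obtain y where "y \<in> S" "y \<noteq> x" "y \<in> nbhd p (F \<union> G) x"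
      using crowded_inD[OF assms(1) x(1) Fpow_Un[OF x(3) G(1)]] .
    moreover have "x \<in> pts p" using x assms unfolding clopen_in_def by blast
    ultimately show ?thesis using G(2)[of x y] x by (auto simp: nbhd_Un)
  qed
  then show ?thesis using assms unfolding crowded_in_def by auto
qed

lemma clopen_in_empty: "clopen_in p {}"
  unfolding clopen_in_def by (auto intro: empty_in_Fpow)

lemma clopen_in_nbhd:
  assumes "G \<in> Fpow (crd p)"
  shows "clopen_in p (nbhd p G a)"
  unfolding clopen_in_def
proof (intro conjI bexI[of _ G] ballI assms nbhd_subset_pts)
  show "y \<in> nbhd p G a \<longleftrightarrow> x \<in> nbhd p G a" if "x \<in> pts p" "y \<in> nbhd p G x" for x y
    using that by (auto simp: nbhd_def)
qed

lemma clopen_in_Un: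
  assumes "clopen_in p V" "clopen_in p W"
  shows "clopen_in p (V \<union> W)"
proof -
  obtain G where G: "G \<in> Fpow (crd p)" "\<And>x y. x \<in> pts p \<Longrightarrow> y \<in> nbhd p G x \<Longrightarrow> y \<in> V \<longleftrightarrow> x \<in> V"
    using assms(1) unfolding clopen_in_def by blast
  obtain H where H: "H \<in> Fpow (crd p)" "\<And>x y. x \<in> pts p \<Longrightarrow> y \<in> nbhd p H x \<Longrightarrow> y \<in> W \<longleftrightarrow> x \<in> W"
    using assms(2) unfolding clopen_in_def by blast
  show ?thesis
    using assms G(2) H(2) Fpow_Un[OF G(1) H(1)] unfolding clopen_in_def
    by (intro conjI bexI[of _ "G \<union> H"]) (auto simp: nbhd_Un)
qed

lemma clopen_inE:
  assumes "clopen_in p V"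
  obtains G where "G \<in> Fpow (crd p)" "\<And>x y. x \<in> pts p \<Longrightarrow> y \<in> nbhd p G x \<Longrightarrow> y \<in> V \<longleftrightarrow> x \<in> V"
  using assms unfolding clopen_in_def by blast

lemma closed_discrete_in_Un:
  assumes "closed_discrete_in p D" "closed_discrete_in p E"
  shows "closed_discrete_in p (D \<union> E)"
  unfolding closed_discrete_in_def
proof (intro conjI ballI)
  show "D \<union> E \<subseteq> pts p" using assms by (auto simp: closed_discrete_in_def)
  fix x assume "x \<in> pts p"
  then obtain F G where "F \<in> Fpow (crd p)" "D \<inter> nbhd p F x \<subseteq> {x}" "G \<in> Fpow (crd p)" "E \<inter> nbhd p G x \<subseteq> {x}"
    using assms unfolding closed_discrete_in_def by meson
  then show "\<exists>F\<in>Fpow (crd p). (D \<union> E) \<inter> nbhd p F x \<subseteq> {x}"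
    by (intro bexI[of _ "F \<union> G"] Fpow_Un) (auto simp: nbhd_Un)
qed

lemma closed_discrete_in_finite:
  assumes "separated p" "finite Y" "Y \<subseteq> pts p"
  shows "closed_discrete_in p Y"
  unfolding closed_discrete_in_def
proof (intro conjI ballI assms)
  fix x assume x: "x \<in> pts p"
  have "\<forall>y\<in>Y - {x}. \<exists>i\<in>crd p. val p x i \<noteq> val p y i"
    using assms x unfolding separated_def by auto
  then obtain c where c: "\<And>y. y \<in> Y - {x} \<Longrightarrow> c y \<in> crd p \<and> val p x (c y) \<noteq> val p y (c y)" by metis
  have "c ` (Y - {x}) \<in> Fpow (crd p)" using c assms(2) by (auto simp: Fpow_def)
  moreover have "Y \<inter> nbhd p (c ` (Y - {x})) x \<subseteq> {x}"
    using c by (auto simp: nbhd_def)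
  ultimately show "\<exists>F\<in>Fpow (crd p). Y \<inter> nbhd p F x \<subseteq> {x}" by blast
qed

lemma closed_discrete_in_UN:
  assumes "separated p" "finite I" "\<And>k. k \<in> I \<Longrightarrow> closed_discrete_in p (D k)"
  shows "closed_discrete_in p (\<Union>k\<in>I. D k)"
  using assms(2,3)
proof (induction I rule: finite_induct)
  case empty
  then show ?case using closed_discrete_in_finite[OF assms(1), of "{}"] by simp
next
  case (insert k I)
  then show ?case using closed_discrete_in_Un by auto
qed

lemma crowded_in_avoid_closed_discrete:
  assumes "crowded_in p S" "closed_discrete_in p D" "x \<in> S" "F \<in> Fpow (crd p)"
  obtains y where "y \<in> S" "y \<notin> D" "y \<in> nbhd p F x"
proof -
  have "x \<in> pts p" using assms(1,3) unfolding crowded_in_def by blast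
  then obtain G where G: "G \<in> Fpow (crd p)" "D \<inter> nbhd p G x \<subseteq> {x}"
    using assms(2) unfolding closed_discrete_in_def by blast
  obtain y where "y \<in> S" "y \<noteq> x" "y \<in> nbhd p (F \<union> G) x"
    using crowded_inD[OF assms(1,3) Fpow_Un[OF assms(4) G(1)]] .
  then show thesis using that[of y] G(2) by (auto simp: nbhd_Un)
qed

text \<open>If the first point \<open>y\<close> found near \<open>x\<close> lies in
  \<open>D\<close>, a second point of \<open>S\<close> is taken so close to \<open>y\<close> that
  \<open>D\<close> has no other point there. A coordinate on which \<open>x\<close> and
  \<open>y\<close> differ keeps this second point away from \<open>x\<close>.\<close>

lemma crowded_in_avoid_discrete:
  assumes "separated p" "crowded_in p S" "discrete_in p D" "x \<in> S" "F \<in> Fpow (crd p)"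
  obtains y where "y \<in> S" "y \<notin> D" "y \<noteq> x" "y \<in> nbhd p F x"
proof -
  obtain y where y: "y \<in> S" "y \<noteq> x" "y \<in> nbhd p F x"
    using crowded_inD[OF assms(2,4,5)] .
  show thesis
  proof (cases "y \<in> D")
    case True
    then obtain G where G: "G \<in> Fpow (crd p)" "D \<inter> nbhd p G y \<subseteq> {y}"
      using assms(3) unfolding discrete_in_def by blast
    have "x \<in> pts p" "y \<in> pts p" using y assms(2,4) unfolding crowded_in_def by auto
    then obtain i where i: "i \<in> crd p" "val p x i \<noteq> val p y i"
      using assms(1) y(2) unfolding separated_def by metis
    have "F \<union> G \<union> {i} \<in> Fpow (crd p)" using assms(5) G i by (simp add: Fpow_def)
    then obtain z where "z \<in> S" "z \<noteq> y" "z \<in> nbhd p (F \<union> G \<union> {i}) y"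
      using crowded_inD[OF assms(2) y(1)] by blast
    moreover from this have "z \<noteq> x" "z \<in> nbhd p F x" "z \<in> nbhd p G y"
      using i y(3) by (auto simp: nbhd_def)
    ultimately show thesis using that[of z] G(2) by blast
  qed (use that y in blast)
qed

section \<open>Adding coordinates\<close>

text \<open>
  The sets \<open>V n\<close> are chosen one after the other, and for each task \<open>(x, S, F)\<close> with \<open>x\<close>
  still uncovered a witness \<open>y\<close> is reserved that all later \<open>V n\<close> must avoid.
\<close>

lemma clopen_sequence_preserving_crowded:
  assumes p: "consistent p" "small p"
    and H: "\<And>S x F. S \<in> insert (pts p) (crw p) \<Longrightarrow> x \<in> S \<Longrightarrow> F \<in> Fpow (crd p) \<Longrightarrow>
              \<exists>y\<in>S \<inter> Z. y \<noteq> x \<and> y \<in> nbhd p F x"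
    and V: "\<And>n Y. finite Y \<Longrightarrow> Y \<subseteq> Z \<Longrightarrow> \<exists>V. P n V \<and> clopen_in p V \<and> V \<inter> Y = {}"
  shows "\<exists>V :: nat \<Rightarrow> 'a set. (\<forall>n. P n (V n) \<and> clopen_in p (V n)) \<and>
           (\<forall>S\<in>insert (pts p) (crw p). \<forall>x\<in>S. \<forall>F\<in>Fpow (crd p).
              \<exists>y\<in>S. y \<noteq> x \<and> y \<in> nbhd p F x \<and> (y \<in> (\<Union>n. V n) \<longleftrightarrow> x \<in> (\<Union>n. V n)))"
proof -
  define K where "K = {(x, S, F). S \<in> insert (pts p) (crw p) \<and> x \<in> S \<and> F \<in> Fpow (crd p)}"
  have crw: "S \<subseteq> pts p" if "S \<in> insert (pts p) (crw p)" for S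
    using p that unfolding consistent_def crowded_in_def by blast
  have "K \<subseteq> pts p \<times> insert (pts p) (crw p) \<times> Fpow (crd p)"
    unfolding K_def using crw by blast
  moreover have "countable (pts p \<times> insert (pts p) (crw p) \<times> Fpow (crd p))"
    using p by (intro countable_SIGMA countable_insert countable_Fpow) (auto simp: small_def)
  ultimately have "countable K" by (rule countable_subset)
  \<comment> \<open>A single task is exhibited only because an enumeration of \<open>K\<close> as a
    range needs \<open>K\<close> nonempty.\<close>
  moreover obtain x0 where "x0 \<in> pts p" using p unfolding consistent_def by blast
  then have "(x0, pts p, {}) \<in> K" unfolding K_def by (auto simp: empty_in_Fpow)
  ultimately obtain e :: "nat \<Rightarrow> _" where e: "range e = K"
    using range_from_nat_into[of K] by blast
  \<comment> \<open>\<open>C\<close> is the union of the sets chosen so far, \<open>Y\<close> the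
    finite set of reserved witnesses, and the third component the set chosen last. Recording
    \<open>C = {}\<close> at the start later gives \<open>C n \<subseteq> W\<close>.\<close>
  define good where "good n s \<longleftrightarrow> (case s of (C, Y, V :: 'a set) \<Rightarrow>
    clopen_in p C \<and> finite Y \<and> Y \<subseteq> Z \<and> C \<inter> Y = {} \<and> (n = 0 \<longrightarrow> C = {}))" for n :: nat and s
  define step where "step n s t \<longleftrightarrow> (case s of (C, Y, V :: 'a set) \<Rightarrow> case t of (C', Y', V') \<Rightarrow>
    P n V' \<and> clopen_in p V' \<and> C' = C \<union> V' \<and> Y \<subseteq> Y' \<and>
    (case e n of (x, S, F) \<Rightarrow> x \<in> C' \<or> (\<exists>y\<in>S \<inter> Y'. y \<noteq> x \<and> y \<in> nbhd p F x)))" for n s t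
  have "\<exists>f. \<forall>n. good n (f n) \<and> step n (f n) (f (Suc n))"
  proof (rule dependent_nat_choice)
    show "\<exists>s. good 0 s" by (rule exI[of _ "({}, {}, {})"]) (simp add: good_def clopen_in_empty)
  next
    fix s n assume "good n s"
    then obtain C Y U where s: "s = (C, Y, U)" "clopen_in p C" "finite Y" "Y \<subseteq> Z" "C \<inter> Y = {}"
      by (auto simp: good_def)
    obtain W where W: "P n W" "clopen_in p W" "W \<inter> Y = {}" using V[OF s(3,4)] by blast
    have C: "clopen_in p (C \<union> W)" using s W clopen_in_Un by blast
    obtain x S F where x: "e n = (x, S, F)" "S \<in> insert (pts p) (crw p)" "x \<in> S" "F \<in> Fpow (crd p)"
      using rangeI[of e n] e unfolding K_def by auto
    show "\<exists>t. good (Suc n) t \<and> step n s t"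
    proof (cases "x \<in> C \<union> W")
      case True
      then have "good (Suc n) (C \<union> W, Y, W) \<and> step n s (C \<union> W, Y, W)"
        using s W C x by (auto simp: good_def step_def)
      then show ?thesis by blast
    next
      case False
      \<comment> \<open>\<open>C \<union> W\<close> depends on the finite set \<open>G\<close> only,
        so agreeing with \<open>x\<close> on \<open>F \<union> G\<close> forces a point to be
        uncovered too. \<open>H\<close> finds one in \<open>Z\<close>, and reserving it keeps it
        uncovered for good.\<close>
      obtain G where G: "G \<in> Fpow (crd p)"
        "\<And>x y. x \<in> pts p \<Longrightarrow> y \<in> nbhd p G x \<Longrightarrow> y \<in> C \<union> W \<longleftrightarrow> x \<in> C \<union> W"
        using clopen_inE[OF C] by metis
      obtain y where "y \<in> S" "y \<in> Z" "y \<noteq> x" "y \<in> nbhd p (F \<union> G) x"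
        using H[OF x(2,3) Fpow_Un[OF x(4) G(1)]] by blast
      moreover have "x \<in> pts p" using x crw by blast
      ultimately have y: "y \<in> S" "y \<in> Z" "y \<noteq> x" "y \<in> nbhd p F x" "y \<notin> C \<union> W"
        using G(2) False by (auto simp: nbhd_Un)
      then have "good (Suc n) (C \<union> W, insert y Y, W) \<and> step n s (C \<union> W, insert y Y, W)"
        using s W C x by (auto simp: good_def step_def)
      then show ?thesis by blast
    qed
  qed
  then obtain f where f: "\<And>n. good n (f n)" "\<And>n. step n (f n) (f (Suc n))" by blast
  define C where "C n = fst (f n)" for n
  define Y where "Y n = fst (snd (f n))" for n
  define U where "U n = snd (snd (f (Suc n)))" for n
  have g: "C n \<inter> Y n = {}" for n
    using f(1)[of n] by (auto simp: good_def C_def Y_def split: prod.splits)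
  have st: "P n (U n)" "clopen_in p (U n)" "C (Suc n) = C n \<union> U n" "Y n \<subseteq> Y (Suc n)"
    "\<And>x S F. e n = (x, S, F) \<Longrightarrow> x \<in> C (Suc n) \<or> (\<exists>y\<in>S \<inter> Y (Suc n). y \<noteq> x \<and> y \<in> nbhd p F x)" for n
    using f(2)[of n] by (auto simp: step_def C_def Y_def U_def split: prod.splits)
  have mono: "C m \<subseteq> C n" "Y m \<subseteq> Y n" if "m \<le> n" for m n
    using lift_Suc_mono_le[of C, OF _ that] lift_Suc_mono_le[of Y, OF _ that] st by auto
  have disj: "Y m \<inter> C n = {}" for m n
    using g[of "max m n"] mono[of m "max m n"] mono[of n "max m n"] by auto
  define W where "W = (\<Union>n. U n)"
  have "C 0 = {}"
    using f(1)[of 0] by (auto simp: good_def C_def split: prod.splits)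
  then have UW: "C n \<subseteq> W" for n
    by (induction n) (auto simp: st(3) W_def)
  have WC: "W \<subseteq> (\<Union>n. C n)" using st(3) unfolding W_def by blast
  show ?thesis
  proof (intro exI[of _ U] conjI allI ballI st(1,2), goal_cases)
    case (1 S x F)
    then have "(x, S, F) \<in> K" by (simp add: K_def)
    then obtain n where n: "e n = (x, S, F)" using e by (metis rangeE)
    show ?case
    \<comment> \<open>Inside \<open>W\<close> some \<open>U m\<close> contains \<open>x\<close>
      together with a whole neighbourhood, so crowdedness of \<open>S\<close> suffices. Outside
      \<open>W\<close> the witness reserved when task \<open>n\<close> was treated is used.\<close>
    proof (cases "x \<in> W")
      case True
      then obtain m where m: "x \<in> U m" unfolding W_def by blast
      obtain G where G: "G \<in> Fpow (crd p)"
        "\<And>x y. x \<in> pts p \<Longrightarrow> y \<in> nbhd p G x \<Longrightarrow> y \<in> U m \<longleftrightarrow> x \<in> U m"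
        using clopen_inE[OF st(2)[of m]] by metis
      have "crowded_in p S" using p 1 unfolding consistent_def by blast
      then obtain y where "y \<in> S" "y \<noteq> x" "y \<in> nbhd p (F \<union> G) x"
        using crowded_inD[OF _ 1(2) Fpow_Un[OF 1(3) G(1)]] by blast
      moreover have "x \<in> pts p" using 1 crw by blast
      ultimately have "y \<in> U m" "y \<in> nbhd p F x" using m G(2)[of x y] by (auto simp: nbhd_Un)
      then show ?thesis using \<open>y \<in> S\<close> \<open>y \<noteq> x\<close> m by blast
    next
      case False
      then have "x \<notin> C (Suc n)" using UW[of "Suc n"] by blast
      then obtain y where "y \<in> S" "y \<in> Y (Suc n)" "y \<noteq> x" "y \<in> nbhd p F x"
        using st(5)[OF n] by blast
      moreover have "y \<notin> W" using WC disj \<open>y \<in> Y (Suc n)\<close> by blast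
      ultimately show ?thesis using False unfolding W_def by blast
    qed
  qed
qed

definition add_coord :: "('a, 'b) cond \<Rightarrow> 'b \<Rightarrow> 'a set \<Rightarrow> ('a, 'b) cond" where
  "add_coord p i W = Cond (pts p) (insert i (crd p)) (\<lambda>x k. if k = i then x \<in> W else val p x k) (crw p) (cdd p)"

lemma consistentD:
  assumes "consistent p"
  shows "pts p \<noteq> {}" "separated p" "S \<in> insert (pts p) (crw p) \<Longrightarrow> crowded_in p S"
    "D \<in> cdd p \<Longrightarrow> closed_discrete_in p D"
  using assms unfolding consistent_def by blast+

lemma crw_subset_pts: "consistent p \<Longrightarrow> S \<in> crw p \<Longrightarrow> S \<subseteq> pts p"
  unfolding consistent_def crowded_in_def by blast

lemma add_coord_sel [simp]:
  "pts (add_coord p i W) = pts p" "crd (add_coord p i W) = insert i (crd p)"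
  "crw (add_coord p i W) = crw p" "cdd (add_coord p i W) = cdd p"
  by (simp_all add: add_coord_def)

lemma nbhd_add_coord_old: "i \<notin> F \<Longrightarrow> nbhd (add_coord p i W) F x = nbhd p F x"
  by (auto simp: nbhd_def add_coord_def)

lemma nbhd_add_coord: "nbhd (add_coord p i W) {i} x = {y \<in> pts p. y \<in> W \<longleftrightarrow> x \<in> W}"
  by (auto simp: nbhd_def add_coord_def)

lemma add_coord_ext: "i \<notin> crd p \<Longrightarrow> p \<unlhd> add_coord p i W"
  unfolding ext_def by (auto simp: add_coord_def)

lemma small_add_coord: "small p \<Longrightarrow> small (add_coord p i W)"
  by (simp add: small_def)

lemma closed_discrete_in_ext:
  assumes "p \<unlhd> q" "pts q = pts p" "closed_discrete_in p D"
  shows "closed_discrete_in q D"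
  unfolding closed_discrete_in_def
proof (intro conjI ballI)
  show "D \<subseteq> pts q" using assms by (simp add: closed_discrete_in_def)
  fix x assume x: "x \<in> pts q"
  then obtain F where F: "F \<in> Fpow (crd p)" "D \<inter> nbhd p F x \<subseteq> {x}"
    using assms unfolding closed_discrete_in_def by auto
  have "nbhd q F x = nbhd p F x"
    using nbhd_ext[OF assms(1), of F x] F x assms(2) nbhd_subset_pts[of q F x] by (auto simp: Fpow_def)
  moreover have "F \<in> Fpow (crd q)" using F(1) assms(1) by (auto simp: Fpow_def ext_def)
  ultimately show "\<exists>F\<in>Fpow (crd q). D \<inter> nbhd q F x \<subseteq> {x}" using F(2) by metis
qed

text \<open>The points stay the same and the topology gets finer, so only crowdedness is at risk. It
  survives if each promised set has, arbitrarily near each of its points, another point on the same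
  side of \<open>W\<close>.\<close>

lemma consistent_add_coord:
  assumes p: "consistent p" and i: "i \<notin> crd p"
    and W: "\<And>S x F. S \<in> insert (pts p) (crw p) \<Longrightarrow> x \<in> S \<Longrightarrow> F \<in> Fpow (crd p) \<Longrightarrow>
              \<exists>y\<in>S. y \<noteq> x \<and> y \<in> nbhd p F x \<and> (y \<in> W \<longleftrightarrow> x \<in> W)"
  shows "consistent (add_coord p i W)" (is "consistent ?q")
proof -
  have "separated ?q"
    unfolding separated_def
  proof (intro ballI impI)
    fix x y assume "x \<in> pts ?q" "y \<in> pts ?q" "x \<noteq> y"
    then obtain k where "k \<in> crd p" "val p x k \<noteq> val p y k"
      using consistentD(2)[OF p] unfolding separated_def by auto
    then show "\<exists>k\<in>crd ?q. val ?q x k \<noteq> val ?q y k"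
      using i by (intro bexI[of _ k]) (auto simp: add_coord_def)
  qed
  moreover have "crowded_in ?q S" if S: "S \<in> insert (pts p) (crw p)" for S
    unfolding crowded_in_def
  proof (intro conjI ballI)
    show "S \<subseteq> pts ?q" using consistentD(3)[OF p S] by (simp add: crowded_in_def)
    fix x F assume x: "x \<in> S" and F: "F \<in> Fpow (crd ?q)"
    then have "F - {i} \<in> Fpow (crd p)" by (auto simp: Fpow_def)
    then obtain y where y: "y \<in> S" "y \<noteq> x" "y \<in> nbhd p (F - {i}) x" "y \<in> W \<longleftrightarrow> x \<in> W"
      using W[OF S x] by blast
    then have "y \<in> nbhd ?q F x" by (auto simp: nbhd_def add_coord_def)
    then show "\<exists>y\<in>S. y \<noteq> x \<and> y \<in> nbhd ?q F x" using y by blast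
  qed
  moreover have "closed_discrete_in ?q D" if "D \<in> cdd p" for D
    using closed_discrete_in_ext[OF add_coord_ext[OF i]] consistentD(4)[OF p that] by simp
  ultimately show ?thesis
    using consistentD(1)[OF p] unfolding consistent_def by simp
qed

section \<open>Making a discrete set closed\<close>

definition mark_cdd :: "('a, 'b) cond \<Rightarrow> 'a set \<Rightarrow> ('a, 'b) cond" where
  "mark_cdd p D = Cond (pts p) (crd p) (val p) (crw p) (insert D (cdd p))"

lemma mark_cdd:
  assumes "consistent p" "closed_discrete_in p D"
  shows "consistent (mark_cdd p D)" "p \<unlhd> mark_cdd p D" "D \<in> cdd (mark_cdd p D)"
    "small p \<Longrightarrow> small (mark_cdd p D)"
proof -
  have "nbhd (mark_cdd p D) = nbhd p" by (intro ext) (simp add: nbhd_def mark_cdd_def)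
  then show "consistent (mark_cdd p D)"
    using assms unfolding consistent_def crowded_in_def closed_discrete_in_def separated_def
    by (simp add: mark_cdd_def)
qed (auto simp: ext_def mark_cdd_def small_def)

text \<open>Around each \<open>d n\<close> a set \<open>V n\<close> with trace \<open>{d n}\<close>
  on \<open>D\<close> is chosen, and the union \<open>W\<close> becomes clopen. Points outside
  \<open>W\<close> are then separated from \<open>D\<close> by the new coordinate, and points of
  \<open>W\<close> lie in some \<open>V n\<close>, which contains only one point of
  \<open>D\<close>. Witnesses are reserved off \<open>D\<close>, so that they never block a
  \<open>d n\<close>; they exist because a discrete set cannot fill a piece of a crowded
  set.\<close>

lemma make_closed_discrete:
  assumes p: "consistent p" "small p" and D: "discrete_in p D" and i: "i \<notin> crd p"
  obtains q where "consistent q" "small q" "p \<unlhd> q" "D \<in> cdd q"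
proof (cases "D = {}")
  case True
  then have "closed_discrete_in p D" unfolding closed_discrete_in_def by (auto intro: empty_in_Fpow)
  then show thesis using mark_cdd[OF p(1)] p that by blast
next
  case False
  have Dp: "D \<subseteq> pts p" using D by (simp add: discrete_in_def)
  then have "countable D" using p(2) countable_subset unfolding small_def by blast
  then obtain d :: "nat \<Rightarrow> _" where d: "range d = D" using range_from_nat_into[OF False] by blast
  define P where "P n V \<longleftrightarrow> V \<inter> D = {d n}" for n V
  have H: "\<exists>y\<in>S \<inter> (pts p - D). y \<noteq> x \<and> y \<in> nbhd p F x"
    if S: "S \<in> insert (pts p) (crw p)" and x: "x \<in> S" and F: "F \<in> Fpow (crd p)" for S x F
  proof -
    obtain y where "y \<in> S" "y \<notin> D" "y \<noteq> x" "y \<in> nbhd p F x"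
      using crowded_in_avoid_discrete[OF consistentD(2)[OF p(1)] consistentD(3)[OF p(1) S] D x F] .
    then have "y \<in> pts p" by (simp add: nbhd_def)
    then show ?thesis using \<open>y \<in> S\<close> \<open>y \<notin> D\<close> \<open>y \<noteq> x\<close> \<open>y \<in> nbhd p F x\<close> by blast
  qed
  have sep: "\<exists>V. P n V \<and> clopen_in p V \<and> V \<inter> Y = {}"
    if 2: "finite Y" "Y \<subseteq> pts p - D" for n Y
  proof -
    have dn: "d n \<in> D" "d n \<in> pts p" using d Dp by auto
    obtain F where F: "F \<in> Fpow (crd p)" "D \<inter> nbhd p F (d n) \<subseteq> {d n}"
      using D dn unfolding discrete_in_def by blast
    have "closed_discrete_in p Y"
      using closed_discrete_in_finite[OF consistentD(2)[OF p(1)] 2(1)] 2(2) by blast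
    then obtain G where G: "G \<in> Fpow (crd p)" "Y \<inter> nbhd p G (d n) \<subseteq> {d n}"
      using dn unfolding closed_discrete_in_def by blast
    have "P n (nbhd p (F \<union> G) (d n))"
      using dn F(2) nbhd_self[OF dn(2)] unfolding P_def by (auto simp: nbhd_Un)
    moreover have "nbhd p (F \<union> G) (d n) \<inter> Y = {}"
      using G(2) 2(2) dn by (auto simp: nbhd_Un)
    ultimately show ?thesis using clopen_in_nbhd[OF Fpow_Un[OF F(1) G(1)]] by blast
  qed
  obtain V where V: "\<And>n. P n (V n)" "\<And>n. clopen_in p (V n)"
    "\<And>S x F. S \<in> insert (pts p) (crw p) \<Longrightarrow> x \<in> S \<Longrightarrow> F \<in> Fpow (crd p) \<Longrightarrow>
              \<exists>y\<in>S. y \<noteq> x \<and> y \<in> nbhd p F x \<and> (y \<in> (\<Union>n. V n) \<longleftrightarrow> x \<in> (\<Union>n. V n))"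
    using clopen_sequence_preserving_crowded[where Z = "pts p - D" and P = P, OF p H sep] by blast
  define W where "W = (\<Union>n. V n)"
  define q where "q = add_coord p i W"
  have q: "consistent q" "p \<unlhd> q" "small q"
    using consistent_add_coord[OF p(1) i] V(3) add_coord_ext[OF i] small_add_coord[OF p(2)]
    unfolding q_def W_def by blast+
  have DW: "D \<subseteq> W" using V(1) d unfolding P_def W_def by blast
  have "closed_discrete_in q D"
    unfolding closed_discrete_in_def
  proof (intro conjI ballI)
    show "D \<subseteq> pts q" using Dp by (simp add: q_def)
    fix x assume x: "x \<in> pts q"
    show "\<exists>F\<in>Fpow (crd q). D \<inter> nbhd q F x \<subseteq> {x}"
    proof (cases "x \<in> W")
      case True
      then obtain n where n: "x \<in> V n" unfolding W_def by blast
      obtain G where G: "G \<in> Fpow (crd p)"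
        "\<And>x y. x \<in> pts p \<Longrightarrow> y \<in> nbhd p G x \<Longrightarrow> y \<in> V n \<longleftrightarrow> x \<in> V n"
        using clopen_inE[OF V(2)[of n]] by metis
      \<comment> \<open>The point \<open>x\<close> of \<open>V n\<close> may differ from
        \<open>d n\<close>, in which case \<open>d n\<close> has to be excluded from its
        neighbourhood as well.\<close>
      have "closed_discrete_in p {d n}"
        using closed_discrete_in_finite[OF consistentD(2)[OF p(1)], of "{d n}"] d Dp by auto
      then obtain F where F: "F \<in> Fpow (crd p)" "{d n} \<inter> nbhd p F x \<subseteq> {x}"
        using x unfolding closed_discrete_in_def q_def by auto
      have "i \<notin> F \<union> G" using F G i by (auto simp: Fpow_def)
      then have "nbhd q (F \<union> G) x = nbhd p (F \<union> G) x" unfolding q_def by (rule nbhd_add_coord_old)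
      moreover have "D \<inter> nbhd p (F \<union> G) x \<subseteq> {x}"
        using F(2) G(2)[of x] n V(1)[of n] x unfolding P_def nbhd_Un q_def by auto
      moreover have "F \<union> G \<in> Fpow (crd q)" using Fpow_Un[OF F(1) G(1)] by (auto simp: q_def Fpow_def)
      ultimately show ?thesis by metis
    next
      case False
      then show ?thesis using DW
        by (intro bexI[of _ "{i}"]) (auto simp: q_def nbhd_add_coord Fpow_def)
    qed
  qed
  from mark_cdd[OF q(1) this] show thesis using that ext_trans[OF q(2)] q(3) by blast
qed

section \<open>Adding points\<close>

text \<open>
  The sets \<open>Z\<close> witness that every neighbourhood of a point of \<open>T\<close> contains points outside the
  closure of \<open>T\<close>; as members of \<open>crw p\<close> they do so in every extension of \<open>p\<close>.
\<close>

definition thin :: "('a, 'b) cond \<Rightarrow> 'a set \<Rightarrow> bool" where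
  "thin p T \<longleftrightarrow> T \<in> crw p \<and>
     (\<forall>v\<in>T. \<exists>Z\<in>crw p. v \<in> Z \<and> (\<forall>y\<in>Z - {v}. \<exists>F\<in>Fpow (crd p). T \<inter> nbhd p F y = {}))"

lemma ext_nbhd_Int:
  assumes "p \<unlhd> q" "F \<in> Fpow (crd p)" "x \<in> pts p" "T \<subseteq> pts p"
  shows "F \<in> Fpow (crd q)" "T \<inter> nbhd q F x = T \<inter> nbhd p F x"
proof -
  show "F \<in> Fpow (crd q)" using assms by (auto simp: ext_def Fpow_def)
  have "F \<subseteq> crd p" using assms(2) by (simp add: Fpow_def)
  then show "T \<inter> nbhd q F x = T \<inter> nbhd p F x" using nbhd_ext[OF assms(1) _ assms(3), of F] assms(4) by blast
qed

text \<open>Both \<open>T\<close> and the witnesses \<open>Z\<close> consist of old points, where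
  old basic sets keep their trace, and \<open>Z\<close> remains promised to be crowded. Plain
  nowhere density would not persist.\<close>

lemma thin_ext:
  assumes "consistent p" "p \<unlhd> q" "thin p T"
  shows "thin q T"
  unfolding thin_def
proof (intro conjI ballI)
  have T: "T \<in> crw p" using assms(3) by (simp add: thin_def)
  then show "T \<in> crw q" using assms(2) by (auto simp: ext_def)
  fix v assume "v \<in> T"
  then obtain Z where Z: "Z \<in> crw p" "v \<in> Z" "\<And>y. y \<in> Z - {v} \<Longrightarrow> \<exists>F\<in>Fpow (crd p). T \<inter> nbhd p F y = {}"
    using assms(3) unfolding thin_def by blast
  show "\<exists>Z\<in>crw q. v \<in> Z \<and> (\<forall>y\<in>Z - {v}. \<exists>F\<in>Fpow (crd q). T \<inter> nbhd q F y = {})"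
  proof (intro bexI[of _ Z] conjI ballI Z(2))
    show "Z \<in> crw q" using Z(1) assms(2) by (auto simp: ext_def)
    fix y assume y: "y \<in> Z - {v}"
    then obtain F where F: "F \<in> Fpow (crd p)" "T \<inter> nbhd p F y = {}" using Z(3) by blast
    moreover have "y \<in> pts p" "T \<subseteq> pts p" using y crw_subset_pts[OF assms(1)] Z(1) T by auto
    ultimately show "\<exists>F\<in>Fpow (crd q). T \<inter> nbhd q F y = {}"
      using ext_nbhd_Int[OF assms(2) F(1)] by metis
  qed
qed

text \<open>
  The new point \<open>y\<close> with \<open>b y = (x, m)\<close> is the \<open>m\<close>-th copy of \<open>x\<close>. The coordinate \<open>j m\<close> is the
  indicator of the \<open>m\<close>-th layer of copies, so the copies of \<open>x\<close> converge to \<open>x\<close>.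
\<close>

definition add_copies :: "('a, 'b) cond \<Rightarrow> 'a set \<Rightarrow> ('a \<Rightarrow> 'a \<times> nat) \<Rightarrow> (nat \<Rightarrow> 'b) \<Rightarrow> ('a, 'b) cond" where
  "add_copies p Y b j = Cond (pts p \<union> Y) (crd p \<union> range j)
     (\<lambda>x k. if k \<in> range j then x \<in> Y \<and> j (snd (b x)) = k else val p (if x \<in> Y then fst (b x) else x) k)
     (crw p \<union> {pts p} \<union> (\<lambda>v. insert v Y) ` pts p) (cdd p)"

text \<open>Any \<open>y\<close> in \<open>Y\<close> is cut off from all old points by the
  coordinate of its layer, while \<open>insert v Y\<close> is crowded for each old \<open>v\<close>;
  hence all old points together form a thin set. Infinitely many layers are needed: a single layer
  coordinate would separate \<open>v\<close> from its copies. The same coordinates keep old closed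
  discrete sets away from the new points.\<close>

lemma add_copies:
  assumes p: "consistent p" "small p" and Y: "Y \<inter> pts p = {}" and b: "bij_betw b Y (pts p \<times> UNIV)"
    and j: "inj j" "range j \<inter> crd p = {}"
  defines "q \<equiv> add_copies p Y b j"
  shows "consistent q" "small q" "p \<unlhd> q" "thin q (pts p)" "Y \<subseteq> pts q"
proof -
  have jc: "j m \<notin> crd p" for m using j(2) by blast
  have v1: "val q x k = val p x k" if "x \<in> pts p" "k \<in> crd p" for x k
    using that Y jc unfolding q_def add_copies_def by auto
  have v2: "\<not> val q x (j m)" if "x \<in> pts p" for x m
    using that Y unfolding q_def add_copies_def by auto
  have v3: "val q y k = val p (fst (b y)) k" if "y \<in> Y" "k \<in> crd p" for y k
    using that Y jc unfolding q_def add_copies_def by auto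
  have v4: "val q y (j m) \<longleftrightarrow> snd (b y) = m" if "y \<in> Y" for y m
    using that j(1) unfolding q_def add_copies_def by (auto dest: injD)
  have sel: "pts q = pts p \<union> Y" "crd q = crd p \<union> range j"
    "crw q = crw p \<union> {pts p} \<union> (\<lambda>v. insert v Y) ` pts p" "cdd q = cdd p"
    by (simp_all add: q_def add_copies_def)
  have bY: "fst (b y) \<in> pts p" if "y \<in> Y" for y
    using b that unfolding bij_betw_def by (metis imageI mem_Times_iff)
  have bex: "\<exists>y\<in>Y. b y = (w, m)" if "w \<in> pts p" for w m
    using b that unfolding bij_betw_def by (metis (no_types) UNIV_I imageE mem_Sigma_iff)
  have cp: "F \<inter> crd p \<in> Fpow (crd p)" if "F \<in> Fpow (crd q)" for F
    using that by (auto simp: Fpow_def)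
  show le: "p \<unlhd> q" unfolding ext_def using sel v1 by auto
  show "Y \<subseteq> pts q" by (simp add: sel)
  have "countable Y"
  proof (rule countable_image_inj_on)
    have "countable (pts p)" using p(2) by (simp add: small_def)
    then show "countable (b ` Y)" using b by (auto simp: bij_betw_def)
    show "inj_on b Y" using b by (simp add: bij_betw_def)
  qed
  then show "small q" using p(2) unfolding small_def by (auto simp: sel)
  have "separated q"
    unfolding separated_def
  proof (intro ballI impI)
    fix x y assume "x \<in> pts q" "y \<in> pts q" "x \<noteq> y"
    then consider "x \<in> pts p" "y \<in> pts p" | "x \<in> pts p" "y \<in> Y" | "x \<in> Y" "y \<in> pts p"
      | "x \<in> Y" "y \<in> Y" "snd (b x) \<noteq> snd (b y)" | "x \<in> Y" "y \<in> Y" "fst (b x) \<noteq> fst (b y)"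
      using b unfolding sel bij_betw_def inj_on_def by (metis Un_iff prod_eqI)
    then show "\<exists>i\<in>crd q. val q x i \<noteq> val q y i"
    proof cases
      case 1
      then obtain i where "i \<in> crd p" "val p x i \<noteq> val p y i"
        using consistentD(2)[OF p(1)] \<open>x \<noteq> y\<close> unfolding separated_def by metis
      then have "i \<in> crd q" "val q x i \<noteq> val q y i" using v1 1 sel(2) by auto
      then show ?thesis by blast
    next
      case 5
      then obtain i where "i \<in> crd p" "val p (fst (b x)) i \<noteq> val p (fst (b y)) i"
        using consistentD(2)[OF p(1)] bY unfolding separated_def by metis
      then have "i \<in> crd q" "val q x i \<noteq> val q y i" using v3 5 sel(2) by auto
      then show ?thesis by blast
    next
      case 2
      then show ?thesis using v2 v4 sel(2) by (intro bexI[of _ "j (snd (b y))"]) auto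
    next
      case 3
      then show ?thesis using v2 v4 sel(2) by (intro bexI[of _ "j (snd (b x))"]) auto
    next
      case 4
      then show ?thesis using v4 sel(2) by (intro bexI[of _ "j (snd (b x))"]) auto
    qed
  qed
  moreover have old: "crowded_in q S" if S: "S \<in> insert (pts p) (crw p)" for S
    unfolding crowded_in_def
  proof (intro conjI ballI)
    have c: "crowded_in p S" using consistentD(3)[OF p(1) S] .
    then show "S \<subseteq> pts q" unfolding crowded_in_def sel by blast
    fix x F assume x: "x \<in> S" and F: "F \<in> Fpow (crd q)"
    obtain y where y: "y \<in> S" "y \<noteq> x" "y \<in> nbhd p (F \<inter> crd p) x"
      using crowded_inD[OF c x cp[OF F]] .
    have "x \<in> pts p" "y \<in> pts p" using c x y unfolding crowded_in_def by auto
    then have "y \<in> nbhd q F x"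
      using y(3) F v1 v2 unfolding nbhd_def sel Fpow_def by auto
    then show "\<exists>y\<in>S. y \<noteq> x \<and> y \<in> nbhd q F x" using y by blast
  qed
  moreover have new: "crowded_in q (insert v Y)" if v: "v \<in> pts p" for v
    unfolding crowded_in_def
  proof (intro conjI ballI)
    show "insert v Y \<subseteq> pts q" using v sel by auto
    fix x F assume x: "x \<in> insert v Y" and F: "F \<in> Fpow (crd q)"
    show "\<exists>y\<in>insert v Y. y \<noteq> x \<and> y \<in> nbhd q F x"
    proof (cases "x = v")
      case True
      \<comment> \<open>A finite \<open>F\<close> leaves some layer \<open>m\<close> unmentioned,
        and the copy of \<open>v\<close> in that layer agrees with \<open>v\<close> on all of
        \<open>F\<close>.\<close>
      have "finite {m. j m \<in> F}" using F j(1) by (simp add: Fpow_def finite_vimageI[of F j, unfolded vimage_def])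
      then obtain m where m: "j m \<notin> F" using ex_new_if_finite[OF infinite_UNIV_nat] by blast
      obtain y where y: "y \<in> Y" "b y = (v, m)" using bex[OF v] by blast
      have "y \<in> nbhd q F v"
        using F v y m v1[OF v] v2[OF v] v3[OF y(1)] v4[OF y(1)] unfolding nbhd_def sel Fpow_def by auto
      moreover have "y \<noteq> v" using y(1) Y v by auto
      ultimately show ?thesis using True y(1) by (intro bexI[of _ y]) auto
    next
      case False
      then have xY: "x \<in> Y" using x by blast
      \<comment> \<open>A copy is approached within its own layer, which imitates the crowded set
        \<open>pts p\<close>.\<close>
      obtain w where w: "w \<noteq> fst (b x)" "w \<in> nbhd p (F \<inter> crd p) (fst (b x))"
        using crowded_inD[OF consistentD(3)[OF p(1)] bY[OF xY] cp[OF F]] by blast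
      have "w \<in> pts p" using w(2) by (simp add: nbhd_def)
      then obtain y where y: "y \<in> Y" "b y = (w, snd (b x))" using bex by blast
      have "y \<in> nbhd q F x"
        using F w y v3[OF y(1)] v4[OF y(1)] v3[OF xY] v4[OF xY] unfolding nbhd_def sel Fpow_def by auto
      moreover have "y \<noteq> x" using y(2) w(1) by (metis fst_conv)
      ultimately show ?thesis using y(1) by (intro bexI[of _ y]) auto
    qed
  qed
  moreover have "crowded_in q (pts q)"
  proof -
    have "pts q = \<Union> ((\<lambda>v. insert v Y) ` pts p)"
      using consistentD(1)[OF p(1)] by (auto simp: sel)
    then show ?thesis using crowded_in_Union[of "(\<lambda>v. insert v Y) ` pts p" q] new by auto
  qed
  moreover have "closed_discrete_in q D" if D: "D \<in> cdd p" for D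
    unfolding closed_discrete_in_def
  proof (intro conjI ballI)
    have c: "closed_discrete_in p D" using consistentD(4)[OF p(1) D] .
    then have Dp: "D \<subseteq> pts p" by (simp add: closed_discrete_in_def)
    then show "D \<subseteq> pts q" by (auto simp: sel)
    fix x assume "x \<in> pts q"
    then consider "x \<in> pts p" | "x \<in> Y" by (auto simp: sel)
    then show "\<exists>F\<in>Fpow (crd q). D \<inter> nbhd q F x \<subseteq> {x}"
    proof cases
      case 1
      then show ?thesis
        using c ext_nbhd_Int[OF le _ 1 Dp] unfolding closed_discrete_in_def by metis
    next
      case 2
      then have "D \<inter> nbhd q {j (snd (b x))} x = {}" using v2 v4 Dp by (auto simp: nbhd_def)
      then show ?thesis by (intro bexI[of _ "{j (snd (b x))}"]) (auto simp: sel Fpow_def)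
    qed
  qed
  ultimately show "consistent q"
    using consistentD(1)[OF p(1)] unfolding consistent_def sel by auto
  show "thin q (pts p)"
    unfolding thin_def
  proof (intro conjI ballI)
    show "pts p \<in> crw q" by (simp add: sel)
    fix v assume v: "v \<in> pts p"
    show "\<exists>Z\<in>crw q. v \<in> Z \<and> (\<forall>y\<in>Z - {v}. \<exists>F\<in>Fpow (crd q). pts p \<inter> nbhd q F y = {})"
    proof (intro bexI[of _ "insert v Y"] conjI ballI)
      fix y assume "y \<in> insert v Y - {v}"
      then have "pts p \<inter> nbhd q {j (snd (b y))} y = {}" using v2 v4 by (auto simp: nbhd_def)
      then show "\<exists>F\<in>Fpow (crd q). pts p \<inter> nbhd q F y = {}"
        by (intro bexI[of _ "{j (snd (b y))}"]) (auto simp: sel Fpow_def)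
    qed (use v sel in auto)
  qed
qed

definition add_point :: "('a, 'b) cond \<Rightarrow> 'a \<Rightarrow> ('b \<Rightarrow> bool) \<Rightarrow> 'a set \<Rightarrow> ('a, 'b) cond" where
  "add_point p z \<xi> S = Cond (insert z (pts p)) (crd p) ((val p)(z := \<xi>)) (insert (insert z S) (crw p)) (cdd p)"

text \<open>\<open>limit\<close> makes the new point a limit of \<open>S\<close>, \<open>new\<close>
  keeps points separated, and the last hypothesis on \<open>D\<close> places the new point outside
  the closure of every promised closed discrete set.\<close>

lemma add_point:
  assumes p: "consistent p" "small p" and z: "z \<notin> pts p" and S: "crowded_in p S"
    and limit: "\<And>F. F \<in> Fpow (crd p) \<Longrightarrow> \<exists>y\<in>S. \<forall>i\<in>F. val p y i = \<xi> i"
    and new: "\<And>y. y \<in> pts p \<Longrightarrow> \<exists>i\<in>crd p. val p y i \<noteq> \<xi> i"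
    and D: "\<And>D. D \<in> cdd p \<Longrightarrow> \<exists>F\<in>Fpow (crd p). \<forall>y\<in>D. \<exists>i\<in>F. val p y i \<noteq> \<xi> i"
  defines "q \<equiv> add_point p z \<xi> S"
  shows "consistent q" "small q" "p \<unlhd> q"
proof -
  have sel: "pts q = insert z (pts p)" "crd q = crd p" "crw q = insert (insert z S) (crw p)" "cdd q = cdd p"
    and vz: "val q z = \<xi>" and vp: "y \<in> pts p \<Longrightarrow> val q y = val p y" for y
    using z by (auto simp: q_def add_point_def)
  show le: "p \<unlhd> q" unfolding ext_def by (auto simp: sel vp)
  show "small q" using p(2) by (simp add: small_def sel)
  have Sp: "S \<subseteq> pts p" using S by (simp add: crowded_in_def)
  have old: "crowded_in q U" if U: "crowded_in p U" for U
    unfolding crowded_in_def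
  proof (intro conjI ballI)
    have Up: "U \<subseteq> pts p" using U by (simp add: crowded_in_def)
    then show "U \<subseteq> pts q" by (auto simp: sel)
    fix x F assume x: "x \<in> U" and F: "F \<in> Fpow (crd q)"
    then obtain y where "y \<in> U" "y \<noteq> x" "y \<in> nbhd p F x"
      using crowded_inD[OF U, of x F] sel(2) by metis
    moreover have "U \<inter> nbhd q F x = U \<inter> nbhd p F x"
      using ext_nbhd_Int(2)[OF le _ _ Up, of F x] F x Up sel(2) by auto
    ultimately show "\<exists>y\<in>U. y \<noteq> x \<and> y \<in> nbhd q F x" by blast
  qed
  \<comment> \<open>Stated for every crowded \<open>U\<close> containing \<open>S\<close>, because
    it is applied both to \<open>S\<close> and to \<open>pts p\<close>.\<close>
  have at_z: "crowded_in q (insert z U)" if U: "crowded_in p U" "S \<subseteq> U" for U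
    unfolding crowded_in_def
  proof (intro conjI ballI)
    have Up: "U \<subseteq> pts p" using that by (simp add: crowded_in_def)
    then show "insert z U \<subseteq> pts q" by (auto simp: sel)
    fix x F assume x: "x \<in> insert z U" and F: "F \<in> Fpow (crd q)"
    show "\<exists>y\<in>insert z U. y \<noteq> x \<and> y \<in> nbhd q F x"
    proof (cases "x = z")
      case True
      obtain y where "y \<in> S" "\<forall>i\<in>F. val p y i = \<xi> i" using limit F sel(2) by metis
      then have "y \<in> nbhd q F z" "y \<noteq> z" using Sp z by (auto simp: nbhd_def sel vz vp)
      moreover have "y \<in> insert z U" using \<open>y \<in> S\<close> U(2) by blast
      ultimately show ?thesis using True by blast
    next
      case False
      then obtain y where "y \<in> U" "y \<noteq> x" "y \<in> nbhd q F x"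
        using crowded_inD[OF old[OF U(1)] _ F, of x] x by blast
      then show ?thesis by blast
    qed
  qed
  have "separated q"
    using consistentD(2)[OF p(1)] new unfolding separated_def sel by (metis insert_iff vz vp)
  moreover have "crowded_in q U" if "U \<in> insert (pts q) (crw q)" for U
    using that old at_z S consistentD(3)[OF p(1)] Sp unfolding sel by blast
  moreover have "closed_discrete_in q D" if Dq: "D \<in> cdd q" for D
    unfolding closed_discrete_in_def
  proof (intro conjI ballI)
    have c: "closed_discrete_in p D" using consistentD(4)[OF p(1)] Dq by (simp add: sel)
    then have Dp: "D \<subseteq> pts p" by (simp add: closed_discrete_in_def)
    then show "D \<subseteq> pts q" by (auto simp: sel)
    fix x assume x: "x \<in> pts q"
    show "\<exists>F\<in>Fpow (crd q). D \<inter> nbhd q F x \<subseteq> {x}"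
    proof (cases "x = z")
      case True
      obtain F where F: "F \<in> Fpow (crd p)" "\<forall>y\<in>D. \<exists>i\<in>F. val p y i \<noteq> \<xi> i"
        using D[of D] Dq sel(4) by auto
      then have "D \<inter> nbhd q F z = {}"
        using Dp by (force simp: nbhd_def vz vp)
      then show ?thesis using F(1) True sel(2) by auto
    next
      case False
      then show ?thesis
        using c ext_nbhd_Int[OF le _ _ Dp] x unfolding closed_discrete_in_def sel by (metis insert_iff)
    qed
  qed
  ultimately show "consistent q" unfolding consistent_def by (simp add: sel)
qed

text \<open>The sets to be selected are \<open>T \<inter> nbhd p (G n) (a n)\<close>, contained in
  the given \<open>nbhd p (F n) (x n)\<close>. Since \<open>z\<close> lies in none of the clopen
  sets \<open>nbhd p (G n) (a n)\<close>, the promised crowdedness at \<open>z\<close> can only be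
  due to infinitely many of them.\<close>

definition accumulates :: "('a, 'b) cond \<Rightarrow> (nat \<Rightarrow> 'a) \<Rightarrow> (nat \<Rightarrow> 'b set) \<Rightarrow> bool" where
  "accumulates p x F \<longleftrightarrow> (\<exists>T a G z. thin p T \<and>
     (\<forall>n. x n \<in> pts p \<and> a n \<in> T \<and> a n \<in> nbhd p (F n) (x n) \<and> F n \<subseteq> G n \<and> G n \<in> Fpow (crd p)) \<and>
     z \<in> pts p \<and> (\<forall>n. z \<notin> nbhd p (G n) (a n)) \<and>
     insert z (\<Union>n. T \<inter> nbhd p (G n) (a n)) \<in> crw p)"

lemma thin_subset_pts: "consistent p \<Longrightarrow> thin p T \<Longrightarrow> T \<subseteq> pts p"
  unfolding thin_def by (blast dest: crw_subset_pts)

text \<open>The sets \<open>nbhd q (G n) (a n)\<close> may gain points, but their intersections with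
  \<open>T\<close> do not change, so the very same set as before is the one promised to be
  crowded.\<close>

lemma accumulates_ext:
  assumes p: "consistent p" and pq: "p \<unlhd> q" and acc: "accumulates p x F"
  shows "accumulates q x F"
proof -
  obtain T a G z where *: "thin p T"
     "\<And>n. x n \<in> pts p \<and> a n \<in> T \<and> a n \<in> nbhd p (F n) (x n) \<and> F n \<subseteq> G n \<and> G n \<in> Fpow (crd p)"
     "z \<in> pts p" "\<And>n. z \<notin> nbhd p (G n) (a n)"
     "insert z (\<Union>n. T \<inter> nbhd p (G n) (a n)) \<in> crw p"
    using acc unfolding accumulates_def by blast
  have T: "T \<subseteq> pts p" using thin_subset_pts[OF p *(1)] .
  have F: "F n \<in> Fpow (crd p)" for n using *(2)[of n] by (auto simp: Fpow_def intro: finite_subset)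
  have eq: "pts p \<inter> nbhd q (G n) (a n) = pts p \<inter> nbhd p (G n) (a n)"
    "pts p \<inter> nbhd q (F n) (x n) = pts p \<inter> nbhd p (F n) (x n)" for n
    using ext_nbhd_Int(2)[OF pq _ _ subset_refl, of "G n" "a n"]
      ext_nbhd_Int(2)[OF pq _ _ subset_refl, of "F n" "x n"] *(2)[of n] F[of n] T by auto
  have sub: "pts p \<subseteq> pts q" "crd p \<subseteq> crd q" "crw p \<subseteq> crw q" using pq by (auto simp: ext_def)
  show ?thesis
    unfolding accumulates_def
  proof (intro exI[of _ T] exI[of _ a] exI[of _ G] exI[of _ z] conjI allI)
    show "thin q T" using thin_ext[OF p pq *(1)] .
    show "x n \<in> pts q" "a n \<in> T" "F n \<subseteq> G n" "G n \<in> Fpow (crd q)" for n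
      using *(2)[of n] sub Fpow_mono by blast+
    show "a n \<in> nbhd q (F n) (x n)" for n using eq(2)[of n] *(2)[of n] T by blast
    show "z \<in> pts q" using *(3) sub by blast
    show "z \<notin> nbhd q (G n) (a n)" for n using eq(1)[of n] *(3,4) by blast
    have "T \<inter> nbhd q (G n) (a n) = T \<inter> nbhd p (G n) (a n)" for n using eq(1)[of n] T by blast
    then show "insert z (\<Union>n. T \<inter> nbhd q (G n) (a n)) \<in> crw q" using *(5) sub(3) by auto
  qed
qed

text \<open>Sequential compactness of the Cantor cube: nested infinite index sets \<open>A k\<close>
  on which the first \<open>k\<close> coordinates are constant, with \<open>\<xi>\<close> collecting
  these constants.\<close>

lemma bool_sequence_cluster:
  fixes f :: "nat \<Rightarrow> 'b \<Rightarrow> bool"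
  assumes "countable I"
  obtains \<xi> where "\<And>F. F \<in> Fpow I \<Longrightarrow> infinite {n. \<forall>i\<in>F. f n i = \<xi> i}"
proof -
  define g where "g n k = f n (from_nat_into I k)" for n k
  have "\<exists>A :: nat \<Rightarrow> nat set. \<forall>k. infinite (A k) \<and> (A (Suc k) \<subseteq> A k \<and> (\<exists>b. \<forall>n\<in>A (Suc k). g n k = b))"
  proof (rule dependent_nat_choice)
    show "\<exists>A :: nat set. infinite A" using infinite_UNIV_nat by blast
  next
    fix A :: "nat set" and k assume "infinite A"
    moreover have "A = {n\<in>A. g n k} \<union> {n\<in>A. \<not> g n k}" by blast
    ultimately have "infinite {n\<in>A. g n k} \<or> infinite {n\<in>A. \<not> g n k}" by (metis finite_Un)
    then show "\<exists>B. infinite B \<and> B \<subseteq> A \<and> (\<exists>b. \<forall>n\<in>B. g n k = b)"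
      by (metis (mono_tags, lifting) mem_Collect_eq subsetI)
  qed
  then obtain A b where A: "\<And>k. infinite (A k)" "\<And>k. A (Suc k) \<subseteq> A k" "\<And>k n. n \<in> A (Suc k) \<Longrightarrow> g n k = b k"
    by metis
  have mono: "A m \<subseteq> A k" if "k \<le> m" for k m
    using lift_Suc_antimono_le[of A, OF A(2) that] .
  show thesis
  proof (rule that[of "\<lambda>i. b (to_nat_on I i)"])
    fix F assume F: "F \<in> Fpow I"
    then obtain K where K: "\<forall>i\<in>F. to_nat_on I i < K"
      by (metis (no_types, lifting) Fpow_def finite_imageI finite_nat_set_iff_bounded image_eqI mem_Collect_eq)
    have "f n i = b (to_nat_on I i)" if "n \<in> A K" "i \<in> F" for n i
    proof -
      have "A K \<subseteq> A (Suc (to_nat_on I i))" using mono K that by (meson Suc_leI)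
      then have "n \<in> A (Suc (to_nat_on I i))" using that by blast
      then have "g n (to_nat_on I i) = b (to_nat_on I i)" by (rule A(3))
      then show ?thesis using assms F that by (auto simp: g_def Fpow_def)
    qed
    then have "A K \<subseteq> {n. \<forall>i\<in>F. f n i = b (to_nat_on I i)}" by blast
    then show "infinite {n. \<forall>i\<in>F. f n i = b (to_nat_on I i)}" using A(1) infinite_super by blast
  qed
qed

text \<open>The values \<open>\<xi>\<close> of the new point are fixed beforehand, as a cluster
  point of the \<open>x n\<close>; since \<open>a n\<close> agrees with \<open>x n\<close> on the
  first \<open>n\<close> coordinates, the \<open>a n\<close> cluster there as well. The extra
  coordinate \<open>i\<close>, the indicator of \<open>W\<close>, is true at \<open>z\<close>, so
  everything outside \<open>W\<close> is kept away from \<open>z\<close>. Thus only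
  \<open>D \<inter> W\<close> could make a promised set \<open>D\<close> accumulate at
  \<open>z\<close>, and it lies in finitely many \<open>V n\<close>, each of which misses
  \<open>z\<close>. Disjointness inside \<open>T\<close> suffices, because the points
  \<open>a n\<close> belong to \<open>T\<close>.\<close>

lemma make_accumulate:
  assumes p: "consistent p" "small p" and T: "thin p T"
    and xF: "\<And>n. x n \<in> T" "\<And>n. F n \<in> Fpow (crd p)"
    and disj: "\<And>m n. m \<noteq> n \<Longrightarrow> T \<inter> nbhd p (F m) (x m) \<inter> nbhd p (F n) (x n) = {}"
    and i: "i \<notin> crd p" and z: "z \<notin> pts p"
  obtains q where "consistent q" "small q" "p \<unlhd> q" "accumulates q x F"
proof -
  define I where "I = crd p"
  have cI: "countable I" using p(2) by (simp add: small_def I_def)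
  have Tp: "T \<subseteq> pts p" using thin_subset_pts[OF p(1) T] .
  have Tc: "crowded_in p T" using consistentD(3)[OF p(1)] T unfolding thin_def by blast
  obtain \<xi> where \<xi>: "\<And>F. F \<in> Fpow I \<Longrightarrow> infinite {n. \<forall>k\<in>F. val p (x n) k = \<xi> k}"
    using bool_sequence_cluster[OF cI, of "\<lambda>n. val p (x n)"] by blast
  define K where "K n = {k\<in>I. to_nat_on I k < n}" for n
  have K: "K n \<in> Fpow I" for n
  proof -
    have "finite (to_nat_on I ` K n)" by (rule finite_subset[of _ "{..<n}"]) (auto simp: K_def)
    moreover have "inj_on (to_nat_on I) (K n)"
      using inj_on_to_nat_on[OF cI] by (rule inj_on_subset) (auto simp: K_def)
    ultimately show ?thesis by (auto simp: Fpow_def K_def dest: finite_imageD)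
  qed
  have large: "\<exists>n>m. G \<subseteq> K n \<and> (\<forall>k\<in>G. val p (x n) k = \<xi> k)" if G: "G \<in> Fpow I" for G m
  proof -
    obtain N where N: "\<forall>k\<in>G. to_nat_on I k < N"
      using G by (metis (no_types, lifting) Fpow_def finite_imageI finite_nat_set_iff_bounded image_eqI mem_Collect_eq)
    obtain n where "n > max m N" "\<forall>k\<in>G. val p (x n) k = \<xi> k"
      using \<xi>[OF G] unfolding infinite_nat_iff_unbounded by blast
    moreover have "G \<subseteq> K n" using N G \<open>n > max m N\<close> by (force simp: K_def Fpow_def)
    ultimately show ?thesis by auto
  qed
  \<comment> \<open>The empty set is added so that an enumeration exists even when nothing has been
    promised yet.\<close>
  have "countable (insert {} (cdd p))" using p(2) by (simp add: small_def)
  then obtain e :: "nat \<Rightarrow> 'a set" where e: "range e = insert {} (cdd p)"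
    using range_from_nat_into[of "insert {} (cdd p)"] by blast
  have ecd: "closed_discrete_in p (e n)" for n
    using consistentD(4)[OF p(1)] rangeI[of e n] closed_discrete_in_finite[OF consistentD(2)[OF p(1)], of "{}"]
    unfolding e by auto
  define E where "E n = (\<Union>k\<in>{..n}. e k)" for n
  have E: "closed_discrete_in p (E n)" for n
    unfolding E_def using closed_discrete_in_UN[OF consistentD(2)[OF p(1)]] ecd by blast
  define P where "P n V \<longleftrightarrow> (\<exists>a G. a \<in> T \<and> a \<in> nbhd p (F n \<union> K n) (x n) \<and> F n \<subseteq> G \<and> G \<in> Fpow I \<and>
      V = nbhd p G a \<and> V \<inter> E n = {})" for n V
  have H: "\<exists>y\<in>S \<inter> pts p. y \<noteq> x \<and> y \<in> nbhd p F x"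
    if S: "S \<in> insert (pts p) (crw p)" and x: "x \<in> S" and F: "F \<in> Fpow (crd p)" for S x F
  proof -
    obtain y where "y \<in> S" "y \<noteq> x" "y \<in> nbhd p F x"
      using crowded_inD[OF consistentD(3)[OF p(1) S] x F] .
    moreover from this have "y \<in> pts p" by (simp add: nbhd_def)
    ultimately show ?thesis by blast
  qed
  have sep: "\<exists>V. P n V \<and> clopen_in p V \<and> V \<inter> Y = {}" if Y: "finite Y" "Y \<subseteq> pts p" for n Y
  proof -
    have c: "closed_discrete_in p (E n \<union> Y)"
      using closed_discrete_in_Un[OF E closed_discrete_in_finite[OF consistentD(2)[OF p(1)] Y]] .
    have FK: "F n \<union> K n \<in> Fpow (crd p)" using Fpow_Un[OF xF(2)] K unfolding I_def .
    \<comment> \<open>\<open>T\<close> is crowded and \<open>E n \<union> Y\<close> closed discrete,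
      so \<open>T\<close> has points near \<open>x n\<close> outside of it; a small neighbourhood of
      such a point then misses \<open>E n \<union> Y\<close> entirely.\<close>
    obtain a where a: "a \<in> T" "a \<notin> E n \<union> Y" "a \<in> nbhd p (F n \<union> K n) (x n)"
      using crowded_in_avoid_closed_discrete[OF Tc c xF(1) FK] .
    obtain G where G: "G \<in> Fpow (crd p)" "(E n \<union> Y) \<inter> nbhd p G a \<subseteq> {a}"
      using c a(1) Tp unfolding closed_discrete_in_def by blast
    have FG: "F n \<union> G \<in> Fpow (crd p)" using Fpow_Un[OF xF(2) G(1)] .
    have "nbhd p (F n \<union> G) a \<inter> (E n \<union> Y) = {}" using G(2) a(2) by (auto simp: nbhd_Un)
    moreover from this have "P n (nbhd p (F n \<union> G) a)"
      unfolding P_def I_def using a FG by (intro exI[of _ a] exI[of _ "F n \<union> G"]) auto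
    ultimately show ?thesis using clopen_in_nbhd[OF FG, of a] by blast
  qed
  obtain V where V: "\<And>n. P n (V n)" "\<And>n. clopen_in p (V n)"
    "\<And>S x F. S \<in> insert (pts p) (crw p) \<Longrightarrow> x \<in> S \<Longrightarrow> F \<in> Fpow (crd p) \<Longrightarrow>
              \<exists>y\<in>S. y \<noteq> x \<and> y \<in> nbhd p F x \<and> (y \<in> (\<Union>n. V n) \<longleftrightarrow> x \<in> (\<Union>n. V n))"
    using clopen_sequence_preserving_crowded[where Z = "pts p" and P = P, OF p H sep] by blast
  define W where "W = (\<Union>n. V n)"
  have "\<exists>a G. \<forall>n. a n \<in> T \<and> a n \<in> nbhd p (F n \<union> K n) (x n) \<and> F n \<subseteq> G n \<and> G n \<in> Fpow I \<and>
      V n = nbhd p (G n) (a n) \<and> V n \<inter> E n = {}"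
    using V(1) unfolding P_def by metis
  then obtain a G where aG: "\<And>n. a n \<in> T" "\<And>n. a n \<in> nbhd p (F n \<union> K n) (x n)" "\<And>n. F n \<subseteq> G n"
    "\<And>n. G n \<in> Fpow I" "\<And>n. V n = nbhd p (G n) (a n)" "\<And>n. V n \<inter> E n = {}" by blast
  have aF: "a n \<in> nbhd p (F n) (x n)" and aK: "a n \<in> nbhd p (K n) (x n)" for n
    using aG(2)[of n] by (auto simp: nbhd_Un)
  have aV: "a n \<in> V n" for n using aG(1)[of n] aG(5)[of n] Tp nbhd_self[of "a n" p] by auto
  \<comment> \<open>If \<open>\<xi>\<close> matched \<open>a n\<close> on \<open>G n\<close>, some
    later \<open>a m\<close> would do so too and would lie in the neighbourhoods belonging to both
    \<open>m\<close> and \<open>n\<close>, against disjointness.\<close>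
  have key: "\<exists>k\<in>G n. val p (a n) k \<noteq> \<xi> k" for n
  proof (rule ccontr)
    assume c: "\<not> (\<exists>k\<in>G n. val p (a n) k \<noteq> \<xi> k)"
    obtain m where m: "m > n" "G n \<subseteq> K m" "\<forall>k\<in>G n. val p (x m) k = \<xi> k"
      using large[OF aG(4)] by blast
    have "a m \<in> nbhd p (G n) (a n)"
      using aK[of m] m c by (force simp: nbhd_def)
    then have "a m \<in> nbhd p (F n) (x n)"
      using nbhd_antimono[OF aG(3)[of n], of p "a n"] nbhd_trans[OF aF[of n]] by blast
    then show False using disj[of m n] m(1) aF[of m] aG(1)[of m] by blast
  qed
  have keyV: "\<exists>k\<in>G n. val p y k \<noteq> \<xi> k" if "y \<in> V n" for n y
    using key[of n] that unfolding aG(5) nbhd_def by auto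
  define p1 where "p1 = add_coord p i W"
  have p1: "consistent p1" "p \<unlhd> p1" "small p1"
    using consistent_add_coord[OF p(1) i] V(3) add_coord_ext[OF i] small_add_coord[OF p(2)]
    unfolding p1_def W_def by blast+
  have sel1: "pts p1 = pts p" "crd p1 = insert i I" "cdd p1 = cdd p" "crw p1 = crw p"
    by (simp_all add: p1_def I_def)
  have val1: "val p1 y i \<longleftrightarrow> y \<in> W" "k \<in> I \<Longrightarrow> val p1 y k = val p y k" for y k
    using i by (auto simp: p1_def add_coord_def I_def)
  define S where "S = (\<Union>n. T \<inter> V n)"
  define \<eta> where "\<eta> = \<xi>(i := True)"
  have \<eta>: "\<eta> i" "k \<in> I \<Longrightarrow> \<eta> k = \<xi> k" for k
    using i by (auto simp: \<eta>_def I_def)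
  define q where "q = add_point p1 z \<eta> S"
  have Tc1: "crowded_in p1 T"
    using consistentD(3)[OF p1(1)] T sel1 unfolding thin_def by auto
  have "G n \<in> Fpow (crd p1)" for n using aG(4)[of n] by (auto simp: sel1 Fpow_def)
  then have "clopen_in p1 (V n)" for n
  proof -
    have "i \<notin> G n" using aG(4)[of n] i by (auto simp: Fpow_def I_def)
    then have "V n = nbhd p1 (G n) (a n)" by (simp add: p1_def nbhd_add_coord_old aG(5))
    then show ?thesis using clopen_in_nbhd \<open>\<And>n. G n \<in> Fpow (crd p1)\<close> by metis
  qed
  then have Sc: "crowded_in p1 S"
    unfolding S_def by (intro crowded_in_Union) (use crowded_in_Int_clopen[OF Tc1] in blast)
  have lim: "\<exists>y\<in>S. \<forall>k\<in>F'. val p1 y k = \<eta> k" if F': "F' \<in> Fpow (crd p1)" for F'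
  proof -
    have "F' - {i} \<in> Fpow I" using F' by (auto simp: sel1 Fpow_def)
    then obtain n where n: "F' - {i} \<subseteq> K n" "\<forall>k\<in>F' - {i}. val p (x n) k = \<xi> k" using large by blast
    have "val p1 (a n) k = \<eta> k" if "k \<in> F'" for k
    proof (cases "k = i")
      case True
      then show ?thesis using val1(1) \<eta>(1) aV[of n] by (auto simp: W_def)
    next
      case False
      then have "k \<in> K n" "val p (x n) k = \<xi> k" using n that by auto
      moreover from this have "k \<in> I" by (simp add: K_def)
      ultimately show ?thesis using aK[of n] val1(2) \<eta>(2) by (auto simp: nbhd_def)
    qed
    then show ?thesis using aG(1)[of n] aV[of n] unfolding S_def by blast
  qed
  have GI: "G n \<subseteq> I" for n using aG(4)[of n] by (simp add: Fpow_def)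
  have new: "\<exists>k\<in>crd p1. val p1 y k \<noteq> \<eta> k" if "y \<in> pts p1" for y
  proof (cases "y \<in> W")
    case True
    then obtain n where "y \<in> V n" unfolding W_def by blast
    then obtain k where "k \<in> G n" "val p y k \<noteq> \<xi> k" using keyV by blast
    then show ?thesis using GI[of n] val1(2) \<eta>(2) sel1 by auto
  next
    case False
    then show ?thesis using val1(1) \<eta>(1) sel1(2) by blast
  qed
  have Dz: "\<exists>F\<in>Fpow (crd p1). \<forall>y\<in>D. \<exists>k\<in>F. val p1 y k \<noteq> \<eta> k" if D: "D \<in> cdd p1" for D
  proof -
    obtain k where k: "D = e k" using D sel1(3) e by (metis insertI2 rangeE)
    \<comment> \<open>\<open>D = e k\<close> misses \<open>V j\<close> for all
      \<open>j \<ge> k\<close>. The finitely many earlier \<open>V j\<close> are excluded by the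
      sets \<open>G j\<close>, and the complement of \<open>W\<close> by \<open>i\<close>.\<close>
    define F' where "F' = insert i (\<Union>j\<in>{..<k}. G j)"
    have "F' \<in> Fpow (crd p1)" using aG(4) by (auto simp: F'_def Fpow_def sel1)
    moreover have "\<exists>k\<in>F'. val p1 y k \<noteq> \<eta> k" if y: "y \<in> D" for y
    proof (cases "y \<in> W")
      case True
      then obtain j where j: "y \<in> V j" unfolding W_def by blast
      have "j < k"
      proof (rule ccontr)
        assume "\<not> j < k"
        then have "k \<in> {..j}" by simp
        then have "D \<subseteq> E j" unfolding k E_def by (rule UN_upper)
        then show False using aG(6)[of j] j y by blast
      qed
      moreover obtain l where "l \<in> G j" "val p y l \<noteq> \<xi> l" using keyV[OF j] by blast
      moreover from this have "val p1 y l \<noteq> \<eta> l" using GI[of j] val1(2) \<eta>(2) by auto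
      ultimately show ?thesis unfolding F'_def by blast
    next
      case False
      then show ?thesis using val1(1) \<eta>(1) unfolding F'_def by blast
    qed
    ultimately show ?thesis by blast
  qed
  have q: "consistent q" "small q" "p1 \<unlhd> q"
    using add_point[OF p1(1,3) _ Sc lim new Dz, of z] z sel1(1) unfolding q_def by auto
  have pq: "p \<unlhd> q" using ext_trans[OF p1(2) q(3)] .
  have zq: "z \<in> pts q" "val q z = \<eta>" "insert z S \<in> crw q"
    by (auto simp: q_def add_point_def)
  have vq: "val q y k = val p y k" if "y \<in> pts p" "k \<in> I" for y k
    using pq that unfolding ext_def I_def by blast
  have TV: "T \<inter> nbhd q (G n) (a n) = T \<inter> V n" for n
    using ext_nbhd_Int(2)[OF pq _ _ Tp, of "G n" "a n"] aG(1,4,5)[of n] Tp unfolding I_def by auto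
  have "accumulates q x F"
    unfolding accumulates_def
  proof (intro exI[of _ T] exI[of _ a] exI[of _ G] exI[of _ z] conjI allI)
    show "thin q T" using thin_ext[OF p(1) pq T] .
    have sub: "pts p \<subseteq> pts q" "crd p \<subseteq> crd q" using pq by (auto simp: ext_def)
    show "x n \<in> pts q" for n using xF(1)[of n] Tp sub by blast
    show "a n \<in> T" "F n \<subseteq> G n" for n using aG by auto
    show "G n \<in> Fpow (crd q)" for n using aG(4)[of n] sub(2) unfolding I_def by (auto simp: Fpow_def)
    show "a n \<in> nbhd q (F n) (x n)" for n
      using ext_nbhd_Int(2)[OF pq xF(2)[of n] _ Tp, of "x n"] aF[of n] aG(1)[of n] xF(1)[of n] Tp by blast
    show "z \<in> pts q" using zq(1) .
    show "z \<notin> nbhd q (G n) (a n)" for n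
    proof -
      obtain k where k: "k \<in> G n" "val p (a n) k \<noteq> \<xi> k" using key by blast
      then have "val q z k \<noteq> val q (a n) k"
        using zq(2) \<eta>(2) vq[of "a n" k] GI[of n] aG(1)[of n] Tp by auto
      then show ?thesis using k(1) by (auto simp: nbhd_def)
    qed
    show "insert z (\<Union>n. T \<inter> nbhd q (G n) (a n)) \<in> crw q" using zq(3) unfolding S_def TV .
  qed
  then show thesis using that q(1,2) pq by blast
qed

section \<open>Chains of approximations and their topology\<close>

text \<open>In a chain all members that know both \<open>x\<close> and \<open>i\<close> agree on the
  value, so it is enough that some member gives the value true.\<close>

definition limit_cond :: "('a, 'b) cond set \<Rightarrow> ('a, 'b) cond" where
  "limit_cond C = Cond (\<Union> (pts ` C)) (\<Union> (crd ` C)) (\<lambda>x i. \<exists>p\<in>C. x \<in> pts p \<and> i \<in> crd p \<and> val p x i)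
     (\<Union> (crw ` C)) (\<Union> (cdd ` C))"

definition ext_chain :: "('a, 'b) cond set \<Rightarrow> bool" where
  "ext_chain C \<longleftrightarrow> (\<forall>p\<in>C. \<forall>q\<in>C. p \<unlhd> q \<or> q \<unlhd> p)"

lemma limit_cond_sel [simp]:
  "pts (limit_cond C) = \<Union> (pts ` C)" "crd (limit_cond C) = \<Union> (crd ` C)"
  "crw (limit_cond C) = \<Union> (crw ` C)" "cdd (limit_cond C) = \<Union> (cdd ` C)"
  by (simp_all add: limit_cond_def)

lemma ext_limit_cond:
  assumes "ext_chain C" "p \<in> C"
  shows "p \<unlhd> limit_cond C"
proof -
  have "val (limit_cond C) x i = val p x i" if "x \<in> pts p" "i \<in> crd p" for x i
  proof -
    have "val q x i = val p x i" if "q \<in> C" "x \<in> pts q" "i \<in> crd q" for q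
      using assms that \<open>x \<in> pts p\<close> \<open>i \<in> crd p\<close> unfolding ext_chain_def ext_def by metis
    moreover have "val (limit_cond C) x i \<longleftrightarrow> (\<exists>q\<in>C. x \<in> pts q \<and> i \<in> crd q \<and> val q x i)"
      by (simp add: limit_cond_def)
    ultimately show ?thesis using assms(2) that by blast
  qed
  then show ?thesis using assms(2) unfolding ext_def by auto
qed

lemma ext_chain_finite:
  assumes C: "ext_chain C" "p \<in> C" and F: "F \<in> Fpow (crd (limit_cond C))"
  obtains q where "q \<in> C" "p \<unlhd> q" "F \<in> Fpow (crd q)"
proof -
  have "finite F" "F \<subseteq> \<Union> (crd ` C)" using F by (auto simp: Fpow_def)
  then have "\<exists>q\<in>C. p \<unlhd> q \<and> F \<in> Fpow (crd q)"
  proof (induction F rule: finite_induct)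
    case empty
    then show ?case using C(2) ext_refl empty_in_Fpow by blast
  next
    case (insert i F)
    then obtain q r where q: "q \<in> C" "p \<unlhd> q" "F \<in> Fpow (crd q)" and r: "r \<in> C" "i \<in> crd r" by auto
    then consider "q \<unlhd> r" | "r \<unlhd> q" using C(1) unfolding ext_chain_def by blast
    then show ?case
    proof cases
      case 1
      then have "insert i F \<in> Fpow (crd r)" using q r by (auto simp: Fpow_def ext_def)
      then show ?thesis using r(1) ext_trans[OF q(2) 1] by blast
    next
      case 2
      then have "insert i F \<in> Fpow (crd q)" using q r by (auto simp: Fpow_def ext_def)
      then show ?thesis using q by blast
    qed
  qed
  then show thesis using that by blast
qed

text \<open>Every single instance of the requirements involves finitely many coordinates and points,
  hence is settled at one member of the chain. Persistence of traces carries the answer to the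
  limit.\<close>

lemma consistent_limit_cond:
  assumes C: "ext_chain C" "C \<noteq> {}" and cons: "\<And>p. p \<in> C \<Longrightarrow> consistent p"
  shows "consistent (limit_cond C)"
proof -
  let ?L = "limit_cond C"
  note le = ext_limit_cond[OF C(1)]
  have upper: "\<exists>r\<in>C. p \<unlhd> r \<and> q \<unlhd> r" if "p \<in> C" "q \<in> C" for p q
    using C(1) that ext_refl unfolding ext_chain_def by blast
  have sep: "separated ?L"
    unfolding separated_def
  proof (intro ballI impI)
    fix x y assume xy: "x \<in> pts ?L" "y \<in> pts ?L" "x \<noteq> y"
    then obtain p q where "p \<in> C" "x \<in> pts p" "q \<in> C" "y \<in> pts q" by auto
    then obtain r where r: "r \<in> C" "x \<in> pts r" "y \<in> pts r"
      using upper unfolding ext_def by (metis subsetD)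
    then obtain i where i: "i \<in> crd r" "val r x i \<noteq> val r y i"
      using consistentD(2)[OF cons[OF r(1)]] xy(3) unfolding separated_def by blast
    then have "i \<in> crd ?L" "val ?L x i \<noteq> val ?L y i"
      using le[OF r(1)] r unfolding ext_def by auto
    then show "\<exists>i\<in>crd ?L. val ?L x i \<noteq> val ?L y i" by blast
  qed
  \<comment> \<open>A promised set is the same at each stage, but \<open>pts ?L\<close> is exhausted
    only gradually; the subset \<open>S'\<close> allows for both cases.\<close>
  have step: "\<exists>y\<in>S. y \<noteq> x \<and> y \<in> nbhd ?L F x"
    if p: "p \<in> C" and S: "\<And>q. q \<in> C \<Longrightarrow> p \<unlhd> q \<Longrightarrow> \<exists>S'\<subseteq>S. x \<in> S' \<and> crowded_in q S'" and F: "F \<in> Fpow (crd ?L)"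
    for p S x F
  proof -
    obtain q where q: "q \<in> C" "p \<unlhd> q" "F \<in> Fpow (crd q)" using ext_chain_finite[OF C(1) p F] .
    obtain S' where S': "S' \<subseteq> S" "x \<in> S'" "crowded_in q S'" using S[OF q(1,2)] by blast
    obtain y where y: "y \<in> S'" "y \<noteq> x" "y \<in> nbhd q F x" using crowded_inD[OF S'(3,2) q(3)] .
    have "S' \<subseteq> pts q" using S'(3) by (simp add: crowded_in_def)
    then have "y \<in> nbhd ?L F x" using ext_nbhd_Int(2)[OF le[OF q(1)] q(3), of x S'] S'(2) y by blast
    then show ?thesis using y S'(1) by blast
  qed
  have crwL: "crowded_in ?L S" if S: "S \<in> crw ?L" for S
  proof -
    obtain p where p: "p \<in> C" "S \<in> crw p" using S by auto
    have c: "crowded_in q S" if "q \<in> C" "p \<unlhd> q" for q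
      using consistentD(3)[OF cons[OF that(1)]] that(2) p(2) unfolding ext_def by blast
    have "S \<subseteq> pts ?L" using c[OF p(1) ext_refl] p(1) by (auto simp: crowded_in_def)
    moreover have "\<exists>y\<in>S. y \<noteq> x \<and> y \<in> nbhd ?L F x" if "x \<in> S" "F \<in> Fpow (crd ?L)" for x F
      using step[OF p(1) _ that(2), of S x] c that(1) by blast
    ultimately show ?thesis unfolding crowded_in_def by blast
  qed
  have ptsL: "crowded_in ?L (pts ?L)"
    unfolding crowded_in_def
  proof (intro conjI ballI subset_refl)
    fix x F assume x: "x \<in> pts ?L" and F: "F \<in> Fpow (crd ?L)"
    obtain p where p: "p \<in> C" "x \<in> pts p" using x by auto
    have "\<exists>S'\<subseteq>pts ?L. x \<in> S' \<and> crowded_in q S'" if "q \<in> C" "p \<unlhd> q" for q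
      using consistentD(3)[OF cons[OF that(1)], of "pts q"] that p by (intro exI[of _ "pts q"]) (auto simp: ext_def)
    then show "\<exists>y\<in>pts ?L. y \<noteq> x \<and> y \<in> nbhd ?L F x" using step[OF p(1) _ F] by blast
  qed
  have cddL: "closed_discrete_in ?L D" if D: "D \<in> cdd ?L" for D
    unfolding closed_discrete_in_def
  proof (intro conjI ballI)
    obtain p where p: "p \<in> C" "D \<in> cdd p" using D by auto
    have Dp: "D \<subseteq> pts p" using consistentD(4)[OF cons[OF p(1)] p(2)] by (simp add: closed_discrete_in_def)
    then show "D \<subseteq> pts ?L" using p(1) by auto
    fix x assume "x \<in> pts ?L"
    then obtain q where q: "q \<in> C" "x \<in> pts q" by auto
    \<comment> \<open>At a stage that has both \<open>x\<close> and the promise on \<open>D\<close>,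
      a finite \<open>F\<close> works; it works in the limit too because \<open>D\<close> gains no
      points.\<close>
    obtain r where r: "r \<in> C" "p \<unlhd> r" "q \<unlhd> r" using upper[OF p(1) q(1)] by blast
    have rx: "x \<in> pts r" "D \<in> cdd r" "D \<subseteq> pts r" using r q(2) p(2) Dp by (auto simp: ext_def)
    then obtain F where F: "F \<in> Fpow (crd r)" "D \<inter> nbhd r F x \<subseteq> {x}"
      using consistentD(4)[OF cons[OF r(1)]] unfolding closed_discrete_in_def by blast
    then show "\<exists>F\<in>Fpow (crd ?L). D \<inter> nbhd ?L F x \<subseteq> {x}"
      using ext_nbhd_Int[OF le[OF r(1)] F(1) rx(1,3)] by metis
  qed
  have "pts ?L \<noteq> {}" using C(2) consistentD(1)[OF cons] by auto
  then show ?thesis unfolding consistent_def using sep crwL ptsL cddL by (metis insertE)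
qed

lemma small_limit_cond:
  assumes "countable C" "\<And>p. p \<in> C \<Longrightarrow> small p"
  shows "small (limit_cond C)"
  using assms unfolding small_def limit_cond_sel by (intro conjI countable_UN) auto

section \<open>The topology of an approximation\<close>

definition cond_topology :: "('a, 'b) cond \<Rightarrow> 'a topology" where
  "cond_topology p = topology (\<lambda>U. U \<subseteq> pts p \<and> (\<forall>x\<in>U. \<exists>F\<in>Fpow (crd p). nbhd p F x \<subseteq> U))"

lemma openin_cond_topology:
  "openin (cond_topology p) U \<longleftrightarrow> U \<subseteq> pts p \<and> (\<forall>x\<in>U. \<exists>F\<in>Fpow (crd p). nbhd p F x \<subseteq> U)"
proof -
  have "istopology (\<lambda>U. U \<subseteq> pts p \<and> (\<forall>x\<in>U. \<exists>F\<in>Fpow (crd p). nbhd p F x \<subseteq> U))"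
    unfolding istopology_def
  proof (intro conjI allI impI ballI, goal_cases)
    case (2 U V x)
    then obtain F G where "F \<in> Fpow (crd p)" "nbhd p F x \<subseteq> U" "G \<in> Fpow (crd p)" "nbhd p G x \<subseteq> V" by blast
    then show ?case by (intro bexI[of _ "F \<union> G"] Fpow_Un) (auto simp: nbhd_Un)
  next
    case (4 \<K> x)
    then show ?case by (meson Union_iff Union_upper subset_trans)
  qed auto
  then show ?thesis unfolding cond_topology_def by (simp add: topology_inverse')
qed

lemma topspace_cond_topology [simp]: "topspace (cond_topology p) = pts p"
proof -
  have "openin (cond_topology p) (pts p)"
    unfolding openin_cond_topology
    by (intro conjI ballI bexI[of _ "{}"]) (simp_all add: nbhd_subset_pts empty_in_Fpow)
  then show ?thesis
    using openin_cond_topology[of p "topspace (cond_topology p)"] openin_subset by auto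
qed

lemma openin_nbhd: "F \<in> Fpow (crd p) \<Longrightarrow> openin (cond_topology p) (nbhd p F x)"
  unfolding openin_cond_topology
  by (intro conjI ballI bexI[of _ F]) (simp_all add: nbhd_subset_pts nbhd_trans)

lemma closedin_nbhd:
  assumes "F \<in> Fpow (crd p)"
  shows "closedin (cond_topology p) (nbhd p F x)"
proof -
  have "nbhd p F y \<subseteq> pts p - nbhd p F x" if "y \<in> pts p - nbhd p F x" for y
    using that by (auto simp: nbhd_def)
  then have "openin (cond_topology p) (pts p - nbhd p F x)"
    unfolding openin_cond_topology using assms by blast
  then show ?thesis by (simp add: closedin_def nbhd_subset_pts)
qed

lemma crowded_in_open:
  assumes "crowded_in p S" "openin (cond_topology p) U" "x \<in> S" "x \<in> U"
  obtains y where "y \<in> S" "y \<in> U" "y \<noteq> x"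
proof -
  obtain F where "F \<in> Fpow (crd p)" "nbhd p F x \<subseteq> U" using assms(2,4) unfolding openin_cond_topology by blast
  then show thesis using crowded_inD[OF assms(1,3), of F] that by blast
qed

lemma crowded_cond_topology:
  assumes "consistent p"
  shows "crowded (cond_topology p)"
  unfolding crowded_def topspace_cond_topology
proof (intro ballI notI)
  fix x assume "x \<in> pts p" "openin (cond_topology p) {x}"
  then show False using crowded_in_open[OF consistentD(3)[OF assms], of "pts p" "{x}" x] by blast
qed

lemma dim_le_0_cond_topology: "cond_topology p dim_le 0"
  unfolding dimension_le_0_neighbourhood_base_of_clopen neighbourhood_base_of
proof (intro allI impI)
  fix W x assume "openin (cond_topology p) W \<and> x \<in> W"
  then obtain F where "F \<in> Fpow (crd p)" "nbhd p F x \<subseteq> W" "x \<in> pts p" unfolding openin_cond_topology by blast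
  then show "\<exists>U V. openin (cond_topology p) U \<and> (closedin (cond_topology p) V \<and> openin (cond_topology p) V) \<and>
      x \<in> U \<and> U \<subseteq> V \<and> V \<subseteq> W"
    using openin_nbhd closedin_nbhd nbhd_self by (metis subset_refl)
qed

lemma Hausdorff_cond_topology:
  assumes "separated p"
  shows "Hausdorff_space (cond_topology p)"
  unfolding Hausdorff_space_def topspace_cond_topology
proof (intro allI impI)
  fix x y assume xy: "x \<in> pts p \<and> y \<in> pts p \<and> x \<noteq> y"
  then obtain i where i: "i \<in> crd p" "val p x i \<noteq> val p y i" using assms unfolding separated_def by blast
  then have "{i} \<in> Fpow (crd p)" by (simp add: Fpow_def)
  moreover have "disjnt (nbhd p {i} x) (nbhd p {i} y)" using i(2) by (auto simp: nbhd_def disjnt_def)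
  ultimately show "\<exists>U V. openin (cond_topology p) U \<and> openin (cond_topology p) V \<and> x \<in> U \<and> y \<in> V \<and> disjnt U V"
    using openin_nbhd nbhd_self xy by metis
qed

lemma discrete_subset_cond_topology:
  assumes "discrete_subset (cond_topology p) D"
  shows "discrete_in p D"
  unfolding discrete_in_def
proof (intro conjI ballI)
  show "D \<subseteq> pts p" using assms by (simp add: discrete_subset_def)
  fix x assume "x \<in> D"
  then obtain U where U: "openin (cond_topology p) U" "U \<inter> D = {x}"
    using assms unfolding discrete_subset_def by blast
  then obtain F where F: "F \<in> Fpow (crd p)" "nbhd p F x \<subseteq> U" unfolding openin_cond_topology by blast
  then have "D \<inter> nbhd p F x \<subseteq> {x}" using U(2) by blast
  then show "\<exists>F\<in>Fpow (crd p). D \<inter> nbhd p F x \<subseteq> {x}" using F(1) by blast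
qed

lemma closedin_cond_topology:
  assumes "closed_discrete_in p D"
  shows "closedin (cond_topology p) D"
proof -
  have "\<exists>F\<in>Fpow (crd p). nbhd p F x \<subseteq> pts p - D" if x: "x \<in> pts p - D" for x
  proof -
    obtain F where "F \<in> Fpow (crd p)" "D \<inter> nbhd p F x \<subseteq> {x}"
      using assms x unfolding closed_discrete_in_def by blast
    moreover from this have "nbhd p F x \<subseteq> pts p - D" using x nbhd_subset_pts[of p F x] by blast
    ultimately show ?thesis by blast
  qed
  then have "openin (cond_topology p) (pts p - D)" unfolding openin_cond_topology by blast
  then show ?thesis using assms by (simp add: closedin_def closed_discrete_in_def)
qed

text \<open>An open set inside the closure of \<open>T\<close> would contain some \<open>v\<close>
  in \<open>T\<close>, hence another point of the crowded witness \<open>Z\<close> for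
  \<open>v\<close>; but that point is outside the closure of \<open>T\<close>.\<close>

lemma nowhere_dense_thin:
  assumes p: "consistent p" and T: "thin p T" and A: "A \<subseteq> T"
  shows "nowhere_dense (cond_topology p) A"
proof -
  let ?X = "cond_topology p"
  have Tp: "T \<subseteq> pts p" using thin_subset_pts[OF p T] .
  have "U = {}" if U: "openin ?X U" "U \<subseteq> ?X closure_of T" for U
  proof (rule ccontr)
    assume "U \<noteq> {}"
    then obtain v where v: "v \<in> T" "v \<in> U"
      using U unfolding closure_of_def by blast
    then obtain Z where Z: "Z \<in> crw p" "v \<in> Z" "\<And>y. y \<in> Z - {v} \<Longrightarrow> \<exists>F\<in>Fpow (crd p). T \<inter> nbhd p F y = {}"
      using T unfolding thin_def by blast
    have "crowded_in p Z" using consistentD(3)[OF p] Z(1) by blast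
    then obtain y where y: "y \<in> Z" "y \<in> U" "y \<noteq> v" using crowded_in_open[OF _ U(1) Z(2) v(2)] by blast
    then obtain F where F: "F \<in> Fpow (crd p)" "T \<inter> nbhd p F y = {}" using Z(3) by blast
    have "y \<in> pts p" using y(2) openin_subset[OF U(1)] by auto
    then show False using y(2) U(2) F openin_nbhd[OF F(1), of y] nbhd_self[of y p F]
      unfolding closure_of_def by blast
  qed
  then have "?X interior_of (?X closure_of T) = {}"
    unfolding interior_of_eq_empty by blast
  moreover have "?X interior_of (?X closure_of A) \<subseteq> ?X interior_of (?X closure_of T)"
    by (intro interior_of_mono closure_of_mono A)
  ultimately show ?thesis unfolding nowhere_dense_def using A Tp by auto
qed

text \<open>Each \<open>A n\<close> is the trace of the crowded set \<open>T\<close> on an open set,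
  hence infinite in a T1 space, and it is nowhere dense as a subset of \<open>T\<close>. The
  accumulation point is the promised \<open>z\<close>.\<close>

lemma accumulates_imp_selection:
  assumes p: "consistent p" and cnt: "\<And>T. T \<in> crw p \<Longrightarrow> countable T" and acc: "accumulates p x F"
  obtains A z where "\<And>n. A n \<in> Nwd_omega (cond_topology p)" "\<And>n. A n \<subseteq> nbhd p (F n) (x n)" "z \<in> pts p"
    "\<And>V. openin (cond_topology p) V \<Longrightarrow> z \<in> V \<Longrightarrow> infinite {n :: nat. A n \<inter> V \<noteq> {}}"
proof -
  let ?X = "cond_topology p"
  obtain T a G z where *: "thin p T"
     "\<And>n. x n \<in> pts p \<and> a n \<in> T \<and> a n \<in> nbhd p (F n) (x n) \<and> F n \<subseteq> G n \<and> G n \<in> Fpow (crd p)"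
     "z \<in> pts p" "\<And>n. z \<notin> nbhd p (G n) (a n)"
     "insert z (\<Union>n. T \<inter> nbhd p (G n) (a n)) \<in> crw p"
    using acc unfolding accumulates_def by blast
  define A where "A n = T \<inter> nbhd p (G n) (a n)" for n
  have Tc: "T \<in> crw p" "crowded_in p T" using *(1) consistentD(3)[OF p] unfolding thin_def by blast+
  have T1: "t1_space ?X" using Hausdorff_imp_t1_space[OF Hausdorff_cond_topology[OF consistentD(2)[OF p]]] .
  have fin: "closedin ?X Y" if "finite Y" "Y \<subseteq> pts p" for Y
    using T1 that unfolding t1_space_closedin_finite by simp
  have Tp: "T \<subseteq> pts p" using thin_subset_pts[OF p *(1)] .
  show thesis
  proof (rule that[of A z])
    fix n
    have an: "a n \<in> T" "a n \<in> nbhd p (G n) (a n)" "G n \<in> Fpow (crd p)" using *(2)[of n] Tp nbhd_self[of "a n" p] by auto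
    have "infinite (A n)"
    proof
      assume "finite (A n)"
      then have "closedin ?X (A n - {a n})" using Tp by (intro fin) (auto simp: A_def)
      then have "openin ?X (nbhd p (G n) (a n) - (A n - {a n}))" using openin_nbhd[OF an(3)] by (rule openin_diff[rotated])
      then obtain y where "y \<in> T" "y \<in> nbhd p (G n) (a n) - (A n - {a n})" "y \<noteq> a n"
        using crowded_in_open[OF Tc(2) _ an(1)] an(2) by blast
      then show False by (auto simp: A_def)
    qed
    moreover have "countable (A n)" using cnt[OF Tc(1)] by (rule countable_subset[rotated]) (auto simp: A_def)
    moreover have "nowhere_dense ?X (A n)" using nowhere_dense_thin[OF p *(1)] by (simp add: A_def)
    ultimately show "A n \<in> Nwd_omega ?X" by (simp add: Nwd_omega_def)
    show "A n \<subseteq> nbhd p (F n) (x n)"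
      using nbhd_antimono[of "F n" "G n" p "a n"] nbhd_trans[of "a n" p "F n" "x n"] *(2)[of n] by (auto simp: A_def)
  next
    show "z \<in> pts p" by (rule *(3))
    fix V assume V: "openin ?X V" "z \<in> V"
    show "infinite {n. A n \<inter> V \<noteq> {}}"
    proof
      assume f: "finite {n. A n \<inter> V \<noteq> {}}"
      \<comment> \<open>If only finitely many \<open>A n\<close> met \<open>V\<close>, removing the
        corresponding closed neighbourhoods, none of which contains \<open>z\<close>, would leave a
        neighbourhood of \<open>z\<close> that misses all \<open>A n\<close>.\<close>
      define W where "W = V - (\<Union>n\<in>{n. A n \<inter> V \<noteq> {}}. nbhd p (G n) (a n))"
      have "closedin ?X (\<Union>n\<in>{n. A n \<inter> V \<noteq> {}}. nbhd p (G n) (a n))"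
        using f *(2) by (intro closedin_Union) (auto intro!: closedin_nbhd)
      then have "openin ?X W" unfolding W_def by (rule openin_diff[OF V(1)])
      moreover have "z \<in> W" using V(2) *(4) by (auto simp: W_def)
      moreover have "crowded_in p (insert z (\<Union>n. A n))"
        using consistentD(3)[OF p] *(5) unfolding A_def by blast
      ultimately obtain y where y: "y \<in> insert z (\<Union>n. A n)" "y \<in> W" "y \<noteq> z"
        using crowded_in_open[of p "insert z (\<Union>n. A n)" W z] by blast
      then obtain n where "y \<in> A n" by blast
      moreover have "y \<in> V" using y(2) by (simp add: W_def)
      ultimately have "y \<notin> W" by (auto simp: W_def A_def)
      then show False using y(2) by simp
    qed
  qed
qed

text \<open>From a countable base, decreasing neighbourhoods \<open>N n\<close> of a point
  \<open>x\<close> are formed, and crowdedness gives \<open>d n\<close> in \<open>N n\<close>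
  different from \<open>x\<close>. The range of this convergent sequence is discrete by the
  Hausdorff property, hence closed, although \<open>x\<close> is a limit of it.\<close>

lemma uncountable_base:
  assumes X: "crowded X" "Hausdorff_space X" "topspace X \<noteq> {}" and B: "base_of X B"
    and cd: "\<And>D. discrete_subset X D \<Longrightarrow> countable D \<Longrightarrow> infinite D \<Longrightarrow> closedin X D"
  shows "uncountable B"
proof
  assume cB: "countable B"
  have B1: "openin X V" if "V \<in> B" for V
    using B that unfolding base_of_def by (metis arbitrary_union_of_inc)
  have B2: "\<exists>V\<in>B. x \<in> V \<and> V \<subseteq> U" if "openin X U" "x \<in> U" for U x
    using B that unfolding base_of_def by (metis arbitrary_union_of_alt)
  have fin: "closedin X Y" if "finite Y" "Y \<subseteq> topspace X" for Y
    using Hausdorff_imp_t1_space[OF X(2)] that unfolding t1_space_closedin_finite by simp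
  obtain x where x: "x \<in> topspace X" using X(3) by blast
  define Bx where "Bx = {V\<in>B. x \<in> V}"
  have "Bx \<noteq> {}" using B2[OF openin_topspace x] unfolding Bx_def by blast
  moreover have "countable Bx" using cB unfolding Bx_def by (rule countable_subset[rotated]) auto
  ultimately obtain e :: "nat \<Rightarrow> _" where e: "range e = Bx" using range_from_nat_into[of Bx] by blast
  define N where "N n = (\<Inter>k\<in>{..n}. e k)" for n
  have eB: "openin X (e k)" "x \<in> e k" for k
    using rangeI[of e k] B1 unfolding e Bx_def by auto
  have N: "openin X (N n)" "x \<in> N n" for n
    unfolding N_def using eB by (auto intro!: openin_INT2)
  have "\<exists>y. y \<in> N n \<and> y \<noteq> x" for n
  proof (rule ccontr)
    assume "\<nexists>y. y \<in> N n \<and> y \<noteq> x"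
    then have "N n = {x}" using N(2) by blast
    then show False using N(1)[of n] X(1) x unfolding crowded_def by auto
  qed
  then obtain d where d: "\<And>n. d n \<in> N n" "\<And>n. d n \<noteq> x" by metis
  have de: "d m \<in> e k" if "k \<le> m" for k m using d(1)[of m] that by (auto simp: N_def)
  define D where "D = range d"
  have DX: "D \<subseteq> topspace X"
    using d(1) openin_subset[OF N(1)] unfolding D_def by blast
  have local: "\<exists>k. e k \<subseteq> U" if "openin X U" "x \<in> U" for U
    using B2[OF that] e unfolding Bx_def by (metis (no_types, lifting) mem_Collect_eq rangeE)
  have "discrete_subset X D"
    unfolding discrete_subset_def
  proof (intro conjI DX ballI)
    fix y assume y: "y \<in> D"
    then have "y \<noteq> x" "y \<in> topspace X" using d(2) DX unfolding D_def by auto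
    then obtain U W where UW: "openin X U" "openin X W" "x \<in> U" "y \<in> W" "disjnt U W"
      using X(2) x unfolding Hausdorff_space_def by metis
    obtain k where k: "e k \<subseteq> U" using local[OF UW(1,3)] by blast
    define Y where "Y = d ` {..<k} - {y}"
    have "closedin X Y" using DX by (intro fin) (auto simp: Y_def D_def)
    then have "openin X (W - Y)" by (rule openin_diff[OF UW(2)])
    moreover have "(W - Y) \<inter> D = {y}"
    proof -
      have "d m \<notin> W" if "k \<le> m" for m
        using de[OF that] k UW(5) unfolding disjnt_def by blast
      then have "D \<inter> W \<subseteq> d ` {..<k}" unfolding D_def by (force simp: not_le)
      then show ?thesis using y UW(4) unfolding Y_def by blast
    qed
    ultimately show "\<exists>U. openin X U \<and> U \<inter> D = {y}" by blast
  qed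
  \<comment> \<open>Values of \<open>d\<close> may repeat. A finite range is closed by T1, so
    infinity of \<open>D\<close> need not be proved.\<close>
  then have "closedin X D" using cd fin DX unfolding D_def by (cases "finite D") (auto simp: D_def)
  then have "openin X (topspace X - D)" by blast
  then obtain k where "e k \<subseteq> topspace X - D" using local[of "topspace X - D"] x d(2) unfolding D_def by auto
  then show False using de[of k k] unfolding D_def by auto
qed

section \<open>The generic limit\<close>

text \<open>Proper initial segments of the cardinal well-order of the reals have smaller
  cardinality, which under CH means that they are countable. \<open>R\<close> is its strict
  part.\<close>

lemma CH_well_order:
  assumes CH
  obtains R :: "real rel" where "wf R" "\<And>x y. x = y \<or> (x, y) \<in> R \<or> (y, x) \<in> R" "\<And>x. countable {y. (y, x) \<in> R}"
proof -
  let ?r = "|UNIV :: real set|"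
  have w: "Well_order ?r" "Field ?r = UNIV" "Card_order ?r"
    by (rule card_of_Well_order Field_card_of card_of_Card_order)+
  have "countable {y. (y, x) \<in> ?r - Id}" for x
  proof -
    have "{y. (y, x) \<in> ?r - Id} = underS ?r x" by (auto simp: underS_def)
    moreover have "|underS ?r x| <o cardSuc natLeq"
      using ordLess_ordIso_trans[OF card_of_underS[OF w(3)] assms[unfolded CH_def]] w(2) by simp
    then have "|underS ?r x| \<le>o natLeq"
      using cardSuc_ordLeq_ordLess[OF natLeq_Card_order card_of_Card_order] by blast
    ultimately show ?thesis by (simp add: countable_card_le_natLeq)
  qed
  moreover have "x = y \<or> (x, y) \<in> ?r - Id \<or> (y, x) \<in> ?r - Id" for x y
    using w(1,2) unfolding well_order_on_def linear_order_on_def total_on_def by auto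
  moreover have "wf (?r - Id)" using w(1) unfolding well_order_on_def by blast
  ultimately show thesis using that by blast
qed

text \<open>Recursion along \<open>R\<close>: the countably many earlier choices are pairwise
  comparable, so they have an upper bound, which is then extended to meet the requirement of the
  current index.\<close>

lemma omega1_chain:
  fixes le :: "'p \<Rightarrow> 'p \<Rightarrow> bool" and R :: "'i rel"
  assumes R: "wf R" "\<And>x y. x = y \<or> (x, y) \<in> R \<or> (y, x) \<in> R" "\<And>x. countable {y. (y, x) \<in> R}"
    and refl: "\<And>p. le p p" and trans: "\<And>p q r. le p q \<Longrightarrow> le q r \<Longrightarrow> le p r" and P0: "P p0"
    and ub: "\<And>C. countable C \<Longrightarrow> C \<noteq> {} \<Longrightarrow> (\<And>p. p \<in> C \<Longrightarrow> P p) \<Longrightarrow>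
               (\<And>p q. p \<in> C \<Longrightarrow> q \<in> C \<Longrightarrow> le p q \<or> le q p) \<Longrightarrow> \<exists>q. P q \<and> (\<forall>p\<in>C. le p q)"
    and dense: "\<And>i p. P p \<Longrightarrow> \<exists>q. P q \<and> le p q \<and> E i q"
  obtains c where "\<And>i. P (c i)" "\<And>i. E i (c i)" "\<And>i j. (i, j) \<in> R \<Longrightarrow> le (c i) (c j)"
proof -
  define Q where "Q f x r \<longleftrightarrow> P r \<and> E x r \<and> (\<forall>y. (y, x) \<in> R \<longrightarrow> le (f y) r)" for f x r
  have "\<exists>f. \<forall>x. Q f x (f x)"
  proof (rule dependent_wf_choice[OF R(1)])
    show "Q f x r = Q g x r" if "\<And>z. (z, x) \<in> R \<Longrightarrow> f z = g z" for f g x r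
      using that by (simp add: Q_def)
  next
    fix x f assume f: "\<And>y. (y, x) \<in> R \<Longrightarrow> Q f y (f y)"
    define C where "C = f ` {y. (y, x) \<in> R}"
    have "\<exists>q. P q \<and> (\<forall>p\<in>C. le p q)"
    proof (cases "C = {}")
      case True
      then show ?thesis using P0 by blast
    next
      case False
      show ?thesis
      proof (rule ub[OF _ False])
        show "countable C" unfolding C_def using R(3) by (rule countable_image)
        show "P p" if "p \<in> C" for p using that f unfolding C_def Q_def by blast
        show "le p q \<or> le q p" if pq: "p \<in> C" "q \<in> C" for p q
        proof -
          obtain y z where yz: "p = f y" "(y, x) \<in> R" "q = f z" "(z, x) \<in> R" using pq C_def by auto
          then show ?thesis using R(2)[of y z] f refl unfolding Q_def by blast
        qed
      qed
    qed
    then obtain q where q: "P q" "\<forall>p\<in>C. le p q" by blast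
    obtain r where r: "P r" "le q r" "E x r" using dense[OF q(1)] by blast
    then have "Q f x r" using q(2) trans unfolding Q_def C_def by blast
    then show "\<exists>r. Q f x r" by blast
  qed
  then obtain c where "\<forall>x. Q c x (c x)" by blast
  then show thesis using that[of c] unfolding Q_def by blast
qed

text \<open>Regularity of \<open>\<omega>\<^sub>1\<close>: an unbounded countable set would make the
  reals a countable union of countable segments.\<close>

lemma countable_bounded:
  fixes R :: "real rel"
  assumes R: "\<And>x y. x = y \<or> (x, y) \<in> R \<or> (y, x) \<in> R" "\<And>x. countable {y. (y, x) \<in> R}" and A: "countable A"
  obtains j where "\<And>i. i \<in> A \<Longrightarrow> (i, j) \<in> R"
proof -
  have "\<exists>j. \<forall>i\<in>A. (i, j) \<in> R"
  proof (rule ccontr)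
    assume "\<nexists>j. \<forall>i\<in>A. (i, j) \<in> R"
    then have "UNIV \<subseteq> (\<Union>i\<in>A. insert i {y. (y, i) \<in> R})" using R(1) by blast
    moreover have "countable (\<Union>i\<in>A. insert i {y. (y, i) \<in> R})" using A R(2) by (intro countable_UN) auto
    ultimately show False using uncountable_UNIV_real countable_subset by blast
  qed
  then show thesis using that by blast
qed

text \<open>Used to index by reals both the tasks of the construction and the members of a base.
  Reals are exchanged with sets of naturals, and pairing codes a sequence of such sets into
  one.\<close>

lemma surj_real_real_seqs:
  obtains s :: "real \<Rightarrow> nat \<Rightarrow> nat \<Rightarrow> real" where "surj s"
proof -
  obtain g :: "nat set \<Rightarrow> real" where g: "bij g"
    using nat_sets_eqpoll_reals unfolding eqpoll_def by blast
  define s where "s r n = g {m. prod_encode (n, m) \<in> inv g r}" for r n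
  have s: "\<exists>r. s r = f" for f
  proof
    have "s (g (prod_encode ` {(n, m). m \<in> inv g (f n)})) n = f n" for n
    proof -
      have "{m. prod_encode (n, m) \<in> prod_encode ` {(n, m). m \<in> inv g (f n)}} = inv g (f n)"
        by (auto simp: image_iff)
      then show ?thesis using g by (simp add: s_def bij_is_inj bij_is_surj surj_f_inv_f)
    qed
    then show "s (g (prod_encode ` {(n, m). m \<in> inv g (f n)})) = f" by blast
  qed
  \<comment> \<open>The coding of simple sequences is applied twice to reach double
    sequences.\<close>
  have "\<exists>r. (\<lambda>n. s (s r n)) = w" for w
  proof -
    have "\<forall>n. \<exists>r. s r = w n" using s by blast
    then obtain v where v: "\<And>n. s (v n) = w n" by metis
    obtain r where "s r = v" using s by blast
    then show ?thesis using v by (intro exI[of _ r]) auto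
  qed
  then have "surj (\<lambda>r n. s (s r n))" by (metis surjI)
  then show thesis by (rule that)
qed

lemma ex_not_in_countable:
  fixes A :: "real set"
  assumes "countable A"
  obtains x where "x \<notin> A"
  using assms uncountable_UNIV_real by (metis UNIV_eq_I)

section \<open>Extending approximations to settle a single task\<close>

abbreviation condition :: "(real, real) cond \<Rightarrow> bool" where
  "condition p \<equiv> consistent p \<and> small p"

text \<open>Serves two purposes: a prescribed real \<open>z\<close> becomes a point, as one of the
  copies, and all points present so far become a thin set.\<close>

lemma thicken:
  fixes p :: "(real, real) cond"
  assumes p: "condition p" and z: "z \<notin> pts p"
  obtains q where "condition q" "p \<unlhd> q" "thin q (pts p)" "z \<in> pts q"
proof -
  have c: "countable (pts p)" "countable (crd p)" using p by (auto simp: small_def)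
  have inf: "infinite (- A)" if "countable A" for A :: "real set"
    using that uncountable_UNIV_real by (metis Compl_partition countable_Un countable_finite)
  obtain Y0 where Y0: "Y0 \<subseteq> - pts p" "infinite Y0" "countable Y0"
    using infinite_countable_subset'[OF inf[OF c(1)]] by blast
  define Y where "Y = insert z Y0"
  have Y: "Y \<inter> pts p = {}" "infinite Y" "countable Y" using Y0 z by (auto simp: Y_def)
  have "infinite (pts p \<times> (UNIV :: nat set))"
    using p consistentD(1)[of p] by (auto simp: finite_cartesian_product_iff)
  then have "bij_betw (to_nat_on Y) Y UNIV" "bij_betw (from_nat_into (pts p \<times> (UNIV :: nat set))) UNIV (pts p \<times> UNIV)"
    using Y c(1) by (simp_all add: to_nat_on_infinite bij_betw_from_nat_into)
  then obtain b :: "real \<Rightarrow> real \<times> nat" where b: "bij_betw b Y (pts p \<times> UNIV)"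
    using bij_betw_trans by blast
  obtain j :: "nat \<Rightarrow> real" where j: "inj j" "range j \<subseteq> - crd p"
    using infinite_countable_subset[OF inf[OF c(2)]] by blast
  then have j': "range j \<inter> crd p = {}" by blast
  show thesis
    using add_copies[OF _ _ Y(1) b j(1) j'] p that Y_def by blast
qed

definition separated_family :: "('a, 'b) cond \<Rightarrow> (nat \<Rightarrow> 'a) \<Rightarrow> (nat \<Rightarrow> 'b set) \<Rightarrow> bool" where
  "separated_family p x F \<longleftrightarrow> (\<forall>n. x n \<in> pts p \<and> F n \<in> Fpow (crd p)) \<and>
     (\<forall>m n. m \<noteq> n \<longrightarrow> nbhd p (F m) (x m) \<inter> nbhd p (F n) (x n) = {})"

text \<open>
  The clauses quantify over all extensions because discreteness and disjointness may only become
  visible at a later stage.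
\<close>

definition decides :: "(nat \<Rightarrow> real) \<Rightarrow> (nat \<Rightarrow> real set) \<Rightarrow> (real, real) cond \<Rightarrow> bool" where
  "decides x F p \<longleftrightarrow> x 0 \<in> pts p \<and>
     (range x \<in> cdd p \<or> (\<nexists>q. condition q \<and> p \<unlhd> q \<and> discrete_in q (range x))) \<and>
     (accumulates p x F \<or> (\<nexists>q. condition q \<and> p \<unlhd> q \<and> separated_family q x F))"

text \<open>For each clause, either an extension showing the discreteness or disjointness exists,
  and it is extended further to fulfil the clause, or none exists. Both outcomes persist in
  extensions, so the clauses can be treated in turn.\<close>

lemma decides_dense:
  assumes p: "condition p"
  shows "\<exists>q. condition q \<and> p \<unlhd> q \<and> decides x F q"
proof -
  obtain p1 where p1: "condition p1" "p \<unlhd> p1" "x 0 \<in> pts p1"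
    using thicken[OF p] p ext_refl by metis
  obtain p2 where p2: "condition p2" "p1 \<unlhd> p2"
    "range x \<in> cdd p2 \<or> (\<nexists>q. condition q \<and> p2 \<unlhd> q \<and> discrete_in q (range x))"
  proof (cases "\<exists>q. condition q \<and> p1 \<unlhd> q \<and> discrete_in q (range x)")
    case True
    then obtain q where q: "condition q" "p1 \<unlhd> q" "discrete_in q (range x)" by blast
    obtain i where "i \<notin> crd q" using ex_not_in_countable q(1) unfolding small_def by metis
    then obtain r where "condition r" "q \<unlhd> r" "range x \<in> cdd r"
      using make_closed_discrete[of q "range x" i] q by blast
    then show thesis using that ext_trans[OF q(2)] by blast
  next
    case False
    then show thesis using that[OF p1(1) ext_refl] by blast
  qed
  obtain p3 where p3: "condition p3" "p2 \<unlhd> p3"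
    "accumulates p3 x F \<or> (\<nexists>q. condition q \<and> p3 \<unlhd> q \<and> separated_family q x F)"
  proof (cases "\<exists>q. condition q \<and> p2 \<unlhd> q \<and> separated_family q x F")
    case True
    then obtain q where q: "condition q" "p2 \<unlhd> q" "separated_family q x F" by blast
    have "countable (pts q)" using q(1) by (simp add: small_def)
    then obtain y where y: "y \<notin> pts q" by (rule ex_not_in_countable)
    \<comment> \<open>All \<open>x n\<close> are points of \<open>q\<close>, so after this step they
      lie in the single thin set \<open>pts q\<close>, which plays the role of
      \<open>T\<close>.\<close>
    obtain r where r: "condition r" "q \<unlhd> r" "thin r (pts q)" using thicken[OF q(1) y] by blast
    have "countable (crd r)" "countable (pts r)" using r(1) by (simp_all add: small_def)
    then obtain i z where iz: "i \<notin> crd r" "z \<notin> pts r" using ex_not_in_countable by metis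
    have x: "x n \<in> pts q" "F n \<in> Fpow (crd q)" for n
      using q(3) by (auto simp: separated_family_def)
    have nb: "F n \<in> Fpow (crd r)" "pts q \<inter> nbhd r (F n) (x n) = nbhd q (F n) (x n)" for n
      using ext_nbhd_Int[OF r(2) x(2,1) subset_refl] nbhd_subset_pts[of q "F n" "x n"] by blast+
    have dis: "pts q \<inter> nbhd r (F m) (x m) \<inter> nbhd r (F n) (x n) = {}" if "m \<noteq> n" for m n
      using nb(2)[of m] nb(2)[of n] q(3) that unfolding separated_family_def by blast
    obtain t where t: "consistent t" "small t" "r \<unlhd> t" "accumulates t x F"
      by (rule make_accumulate[OF conjunct1[OF r(1)] conjunct2[OF r(1)] r(3) x(1) nb(1) dis iz])
    have "p2 \<unlhd> t" using q(2) r(2) t(3) by (meson ext_trans)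
    then show thesis using that t by blast
  next
    case False
    then show thesis using that[OF p2(1) ext_refl] by blast
  qed
  have "x 0 \<in> pts p3" using p1(3) p2(2) p3(2) by (auto simp: ext_def)
  moreover have "range x \<in> cdd p3 \<or> (\<nexists>q. condition q \<and> p3 \<unlhd> q \<and> discrete_in q (range x))"
  proof -
    have "cdd p2 \<subseteq> cdd p3" using p3(2) by (simp add: ext_def)
    then show ?thesis using p2(3) ext_trans[OF p3(2)] by blast
  qed
  ultimately have "decides x F p3" unfolding decides_def using p3(3) by blast
  then show ?thesis using p3(1) ext_trans[OF ext_trans[OF p1(2) p2(2)] p3(2)] by blast
qed

text \<open>The start is a copy of the finitely supported 0-1 sequences: naturals as points, binary
  digits as coordinates. Flipping a digit outside a finite \<open>F\<close> gives a different point
  agreeing on \<open>F\<close>, and naturals with equal digits are equal.\<close>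

lemma ex_condition: "\<exists>p. condition p"
proof -
  define p :: "(real, real) cond" where
    "p = Cond (range real) (range real) (\<lambda>x i. bit (nat \<lfloor>x\<rfloor>) (nat \<lfloor>i\<rfloor>)) {} {}"
  have "separated p"
    unfolding separated_def p_def
  proof (clarsimp, goal_cases)
    case (1 m n)
    then show ?case by (metis bit_eq_iff)
  qed
  moreover have "crowded_in p (pts p)"
    unfolding crowded_in_def
  proof (intro conjI ballI subset_refl)
    fix x F assume "x \<in> pts p" and F: "F \<in> Fpow (crd p)"
    then obtain n where n: "x = real n" by (auto simp: p_def)
    have "finite (real -` F)" using F by (intro finite_vimageI) (auto simp: Fpow_def)
    then obtain k where k: "real k \<notin> F" using ex_new_if_finite[OF infinite_UNIV_nat] by blast
    have "bit (flip_bit k n) k \<noteq> bit n k" by (simp add: bit_simps)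
    then have "real (flip_bit k n) \<noteq> x" using n by auto
    moreover have "real (flip_bit k n) \<in> nbhd p F x"
      using F k unfolding n nbhd_def p_def Fpow_def by (auto simp: bit_simps)
    ultimately show "\<exists>y\<in>pts p. y \<noteq> x \<and> y \<in> nbhd p F x" by (auto simp: p_def)
  qed
  moreover have "pts p \<noteq> {}" "crw p = {}" "cdd p = {}" by (simp_all add: p_def)
  moreover have "small p" by (simp add: small_def p_def)
  ultimately have "condition p" unfolding consistent_def by simp
  then show ?thesis by blast
qed

text \<open>Discreteness or disjointness in the limit is witnessed by countably many points and
  finite sets of coordinates, all present at some stage above the one that treated the task. The
  negative alternative of \<open>decides\<close> is thereby refuted, so the task was fulfilled, and
  this persists in the limit.\<close>

lemma CH_generic_limit:
  assumes CH
  obtains p :: "(real, real) cond" where "consistent p" "pts p = UNIV" "\<And>T. T \<in> crw p \<Longrightarrow> countable T"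
    "\<And>x :: nat \<Rightarrow> real. discrete_in p (range x) \<Longrightarrow> closed_discrete_in p (range x)"
    "\<And>x F. separated_family p x F \<Longrightarrow> (\<And>n. F n \<noteq> {}) \<Longrightarrow> accumulates p x F"
proof -
  obtain R :: "real rel" where R: "wf R" "\<And>x y. x = y \<or> (x, y) \<in> R \<or> (y, x) \<in> R" "\<And>x. countable {y. (y, x) \<in> R}"
    using CH_well_order[OF assms] by blast
  obtain s :: "real \<Rightarrow> nat \<Rightarrow> nat \<Rightarrow> real" where s: "surj s" using surj_real_real_seqs .
  \<comment> \<open>Row \<open>n\<close> of the code \<open>s i\<close> holds \<open>x n\<close> as
    entry 0 and lists \<open>F n\<close> from entry 1 on. Only nonempty sets are such ranges, hence
    the condition \<open>F n \<noteq> {}\<close> in the last conclusion.\<close>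
  define E where "E i = decides (\<lambda>n. s i n 0) (\<lambda>n. range (\<lambda>k. s i n (Suc k)))" for i
  obtain p0 where p0: "condition p0" using ex_condition by blast
  obtain c where c: "\<And>i. condition (c i)" "\<And>i. E i (c i)" "\<And>i j. (i, j) \<in> R \<Longrightarrow> c i \<unlhd> c j"
  proof (rule omega1_chain[where le = ext and P = condition and E = E, OF R ext_refl ext_trans p0])
    fix C :: "(real, real) cond set"
    assume C: "countable C" "C \<noteq> {}" "\<And>p. p \<in> C \<Longrightarrow> condition p" "\<And>p q. p \<in> C \<Longrightarrow> q \<in> C \<Longrightarrow> p \<unlhd> q \<or> q \<unlhd> p"
    then have "ext_chain C" by (simp add: ext_chain_def)
    then show "\<exists>q. condition q \<and> (\<forall>p\<in>C. p \<unlhd> q)"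
      using C consistent_limit_cond small_limit_cond ext_limit_cond by metis
  next
    show "\<exists>q. condition q \<and> p \<unlhd> q \<and> E i q" if "condition p" for i p
      unfolding E_def by (rule decides_dense[OF that])
  next
    fix c' :: "real \<Rightarrow> (real, real) cond"
    assume "\<And>i. condition (c' i)" "\<And>i. E i (c' i)" "\<And>i j. (i, j) \<in> R \<Longrightarrow> c' i \<unlhd> c' j"
    then show thesis by (rule that)
  qed
  define L where "L = limit_cond (range c)"
  have chain: "ext_chain (range c)"
  proof -
    have "c i \<unlhd> c j \<or> c j \<unlhd> c i" for i j
      using R(2)[of i j] c(3)[of i j] c(3)[of j i] ext_refl[of "c i"] by auto
    then show ?thesis by (simp add: ext_chain_def)
  qed
  have cL: "c i \<unlhd> L" for i unfolding L_def using ext_limit_cond[OF chain] by blast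
  have L: "consistent L" unfolding L_def using consistent_limit_cond[OF chain] c(1) by blast
  \<comment> \<open>Each \<open>n\<close> needs one stage, and the countably many stages, together
    with \<open>i\<close>, have a common bound.\<close>
  have absorb: "\<exists>j. c i \<unlhd> c j \<and> (\<forall>n. x n \<in> pts (c j) \<and> F n \<in> Fpow (crd (c j)))"
    if xF: "\<And>n. x n \<in> pts L" "\<And>n. F n \<in> Fpow (crd L)" for i and x :: "nat \<Rightarrow> real" and F
  proof -
    have "\<exists>k. x n \<in> pts (c k) \<and> F n \<in> Fpow (crd (c k))" for n
    proof -
      obtain l where l: "x n \<in> pts (c l)" using xF(1)[of n] by (auto simp: L_def)
      obtain q where "q \<in> range c" "c l \<unlhd> q" "F n \<in> Fpow (crd q)"
        using ext_chain_finite[OF chain rangeI xF(2)[of n, unfolded L_def], of l] .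
      then show ?thesis using l unfolding ext_def by (metis rangeE subsetD)
    qed
    then obtain k where k: "\<And>n. x n \<in> pts (c (k n))" "\<And>n. F n \<in> Fpow (crd (c (k n)))" by metis
    obtain j where j: "\<And>i'. i' \<in> insert i (range k) \<Longrightarrow> (i', j) \<in> R"
      using countable_bounded[OF R(2,3), of "insert i (range k)"] by auto
    have "c (k n) \<unlhd> c j" "c i \<unlhd> c j" for n using c(3) j by auto
    then have "x n \<in> pts (c j)" "F n \<in> Fpow (crd (c j))" "c i \<unlhd> c j" for n
      using k[of n] unfolding ext_def Fpow_def by blast+
    then show ?thesis by blast
  qed
  have nbL: "pts (c j) \<inter> nbhd L F y = nbhd (c j) F y" if "F \<in> Fpow (crd (c j))" "y \<in> pts (c j)" for j F y
    using ext_nbhd_Int(2)[OF cL that subset_refl] nbhd_subset_pts[of "c j" F y] by blast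
  show thesis
  proof (rule that[OF L])
    show "pts L = UNIV"
    proof (rule UNIV_eq_I[symmetric])
      fix y
      \<comment> \<open>The task of the constant sequence forces \<open>y\<close> in, since
        \<open>decides\<close> demands that the first term be a point.\<close>
      obtain i where "s i = (\<lambda>_ _. y)" using s by (metis surjD)
      then have "y \<in> pts (c i)" using c(2)[of i] by (simp add: E_def decides_def)
      then show "y \<in> pts L" by (auto simp: L_def)
    qed
  next
    fix T assume "T \<in> crw L"
    then obtain i where i: "T \<in> crw (c i)" by (auto simp: L_def)
    have "T \<subseteq> pts (c i)" using crw_subset_pts c(1) i by blast
    moreover have "countable (pts (c i))" using c(1)[of i] by (simp add: small_def)
    ultimately show "countable T" by (rule countable_subset)
  next
    fix x :: "nat \<Rightarrow> real" assume x: "discrete_in L (range x)"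
    then have "\<forall>n. \<exists>F\<in>Fpow (crd L). range x \<inter> nbhd L F (x n) \<subseteq> {x n}" "\<And>n. x n \<in> pts L"
      unfolding discrete_in_def by auto
    then obtain F where F: "\<And>n. F n \<in> Fpow (crd L)" "\<And>n. range x \<inter> nbhd L (F n) (x n) \<subseteq> {x n}"
      and xL: "\<And>n. x n \<in> pts L" by metis
    obtain i where i: "s i = (\<lambda>n _. x n)" using s by (metis surjD)
    obtain j where j: "c i \<unlhd> c j" "\<And>n. x n \<in> pts (c j)" "\<And>n. F n \<in> Fpow (crd (c j))"
      using absorb[where x = x and F = F, OF xL F(1)] by blast
    have "range x \<inter> nbhd (c j) (F n) (x n) \<subseteq> {x n}" for n
      using nbL[OF j(3,2), of n n] F(2)[of n] by blast
    then have "discrete_in (c j) (range x)"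
      unfolding discrete_in_def using j(2,3) by blast
    moreover have "decides x (\<lambda>n. range (\<lambda>k. x n)) (c i)"
      using c(2)[of i] unfolding E_def i by simp
    ultimately have "range x \<in> cdd (c i)" unfolding decides_def using c(1) j(1) by blast
    then have "range x \<in> cdd L" by (auto simp: L_def)
    then show "closed_discrete_in L (range x)" by (rule consistentD(4)[OF L])
  next
    fix x :: "nat \<Rightarrow> real" and F :: "nat \<Rightarrow> real set" assume xF: "separated_family L x F" and ne: "\<And>n. F n \<noteq> {}"
    then have xL: "\<And>n. x n \<in> pts L" "\<And>n. F n \<in> Fpow (crd L)"
      "\<And>m n. m \<noteq> n \<Longrightarrow> nbhd L (F m) (x m) \<inter> nbhd L (F n) (x n) = {}"
      unfolding separated_family_def by blast+
    obtain i where i: "s i = (\<lambda>n k. case k of 0 \<Rightarrow> x n | Suc l \<Rightarrow> from_nat_into (F n) l)" using s by (metis surjD)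
    have "countable (F n)" for n using xL(2)[of n] by (auto simp: Fpow_def intro: countable_finite)
    then have Fi: "range (\<lambda>k. s i n (Suc k)) = F n" for n
      using range_from_nat_into[OF ne[of n]] by (simp add: i)
    obtain j where j: "c i \<unlhd> c j" "\<And>n. x n \<in> pts (c j)" "\<And>n. F n \<in> Fpow (crd (c j))"
      using absorb[where x = x and F = F, OF xL(1,2)] by blast
    have "nbhd (c j) (F m) (x m) \<inter> nbhd (c j) (F n) (x n) = {}" if "m \<noteq> n" for m n
      using nbL[OF j(3,2), of n n] nbL[OF j(3,2), of m m] xL(3)[OF that] by blast
    then have "separated_family (c j) x F"
      unfolding separated_family_def using j(2,3) by blast
    moreover have "decides x F (c i)"
    proof -
      have "(\<lambda>n. s i n 0) = x" by (simp add: i)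
      then show ?thesis using c(2)[of i] unfolding E_def Fi by simp
    qed
    ultimately have "accumulates (c i) x F" unfolding decides_def using c(1) j(1) by blast
    then show "accumulates L x F" using accumulates_ext cL c(1) by blast
  qed
qed

text \<open>The lower bound holds because no base is countable. For the upper bound, a basic set is
  given by a point and a finite set of coordinates, hence coded by a real, and CH gives the
  cardinality.\<close>

lemma weight_cond_topology:
  fixes p :: "(real, real) cond"
  assumes CH and p: "consistent p" "pts p = UNIV"
    and cd: "\<And>D. discrete_subset (cond_topology p) D \<Longrightarrow> countable D \<Longrightarrow> infinite D \<Longrightarrow> closedin (cond_topology p) D"
    and i0: "i0 \<in> crd p"
  shows "weight_eq (cond_topology p) (cardSuc natLeq)"
proof -
  let ?X = "cond_topology p"
  have unc: "uncountable B" if "base_of ?X B" for B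
    using uncountable_base[OF crowded_cond_topology[OF p(1)] Hausdorff_cond_topology[OF consistentD(2)[OF p(1)]] _ that cd] p(2)
    by auto
  have lower: "cardSuc natLeq \<le>o |B|" if "base_of ?X B" for B :: "real set set"
  proof -
    have "\<not> |B| \<le>o natLeq" using unc[OF that] by (simp add: countable_card_le_natLeq)
    then have "natLeq <o |B|"
      using not_ordLeq_iff_ordLess[OF natLeq_Well_order card_of_Well_order] by blast
    then show ?thesis using cardSuc_ordLess_ordLeq[OF natLeq_Card_order card_of_Card_order] by blast
  qed
  \<comment> \<open>Nonempty \<open>F\<close> can be coded as ranges of sequences; enlarging any
    \<open>F\<close> by \<open>i0\<close> shows that these sets still form a base.\<close>
  define B where "B = {nbhd p F x | F x. F \<in> Fpow (crd p) \<and> F \<noteq> {}}"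
  have "base_of ?X B"
    unfolding base_of_def
  proof (intro ext)
    fix U
    have "\<exists>V. V \<in> B \<and> x \<in> V \<and> V \<subseteq> U" if U: "openin ?X U" and x: "x \<in> U" for x
    proof -
      obtain F where F: "F \<in> Fpow (crd p)" "nbhd p F x \<subseteq> U" using U x unfolding openin_cond_topology by blast
      have "insert i0 F \<in> Fpow (crd p)" using F(1) i0 by (simp add: Fpow_def)
      moreover have "nbhd p (insert i0 F) x \<subseteq> U" using F(2) nbhd_antimono[of F "insert i0 F" p x] by blast
      moreover have "x \<in> nbhd p (insert i0 F) x" using p(2) nbhd_self[of x p] by simp
      ultimately show ?thesis unfolding B_def by blast
    qed
    moreover have "openin ?X V" if "V \<in> B" for V using that unfolding B_def by (auto intro: openin_nbhd)
    ultimately show "openin ?X U = (arbitrary union_of (\<lambda>V. V \<in> B)) U"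
      unfolding arbitrary_union_of_alt using openin_subopen by metis
  qed
  moreover have "|B| =o cardSuc natLeq"
  proof -
    obtain s :: "real \<Rightarrow> nat \<Rightarrow> nat \<Rightarrow> real" where s: "surj s" using surj_real_real_seqs .
    have "B \<subseteq> (\<lambda>r. nbhd p (range (s r 1)) (s r 0 0)) ` UNIV"
    proof
      fix V assume "V \<in> B"
      then obtain F x where V: "V = nbhd p F x" "F \<in> Fpow (crd p)" "F \<noteq> {}" unfolding B_def by blast
      then have "range (from_nat_into F) = F"
        by (intro range_from_nat_into) (auto simp: Fpow_def intro: countable_finite)
      moreover obtain r where "s r = (\<lambda>n k. if n = 0 then x else from_nat_into F k)" using s by (metis surjD)
      ultimately have "V = nbhd p (range (s r 1)) (s r 0 0)" using V(1) by simp
      then show "V \<in> (\<lambda>r. nbhd p (range (s r 1)) (s r 0 0)) ` UNIV" by blast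
    qed
    then have "|B| \<le>o |UNIV :: real set|"
      by (rule ordLeq_transitive[OF card_of_mono1 card_of_image])
    then have "|B| \<le>o cardSuc natLeq" using ordLeq_ordIso_trans \<open>CH\<close>[unfolded CH_def] by blast
    then show ?thesis using lower[OF \<open>base_of ?X B\<close>] by (simp add: ordIso_iff_ordLeq)
  qed
  ultimately show ?thesis unfolding weight_eq_def using lower by blast
qed

theorem theorem3p1:
  assumes "CH"
  shows "\<exists>X :: real topology.
           crowded X \<and> X dim_le 0 \<and> Hausdorff_space X \<and>
           card_of (topspace X) =o cardSuc natLeq \<and> weight_eq X (cardSuc natLeq) \<and>
           (\<forall>D. discrete_subset X D \<and> countable D \<and> infinite D \<longrightarrow> closedin X D) \<and>
           selectively_pseudocompact (Nwd_omega X) X"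
proof -
  obtain p :: "(real, real) cond" where p: "consistent p" "pts p = UNIV" "\<And>T. T \<in> crw p \<Longrightarrow> countable T"
    "\<And>x :: nat \<Rightarrow> real. discrete_in p (range x) \<Longrightarrow> closed_discrete_in p (range x)"
    "\<And>x F. separated_family p x F \<Longrightarrow> (\<And>n. F n \<noteq> {}) \<Longrightarrow> accumulates p x F"
    using CH_generic_limit[OF assms] by blast
  define X where "X = cond_topology p"
  have cd: "closedin X D" if D: "discrete_subset X D" "countable D" "infinite D" for D
  proof -
    have "D \<noteq> {}" using D(3) by auto
    then obtain x :: "nat \<Rightarrow> real" where x: "range x = D" using range_from_nat_into[of D] D(2) by blast
    show ?thesis
      using closedin_cond_topology[OF p(4)] discrete_subset_cond_topology D(1) x unfolding X_def by metis
  qed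
  have "(0 :: real) \<in> pts p" "(1 :: real) \<in> pts p" by (simp_all add: p(2))
  \<comment> \<open>Two distinct points must differ somewhere, so a coordinate exists; adding it to
    finite sets of coordinates makes them nonempty, as the coding requires.\<close>
  then obtain i0 where i0: "i0 \<in> crd p"
    using consistentD(2)[OF p(1)] unfolding separated_def by (metis zero_neq_one)
  have "selectively_pseudocompact (Nwd_omega X) X"
    unfolding selectively_pseudocompact_def
  proof (intro allI impI)
    fix U :: "nat \<Rightarrow> real set"
    assume U: "(\<forall>n. openin X (U n) \<and> U n \<noteq> {}) \<and> pairwise (\<lambda>m n. disjnt (U m) (U n)) UNIV"
    have "\<exists>x F. F \<in> Fpow (crd p) \<and> F \<noteq> {} \<and> nbhd p F x \<subseteq> U n" for n
    proof -
      obtain x where "x \<in> U n" using U by blast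
      then obtain F where F: "F \<in> Fpow (crd p)" "nbhd p F x \<subseteq> U n"
        using U unfolding X_def openin_cond_topology by blast
      have "insert i0 F \<in> Fpow (crd p)" using F(1) i0 by (simp add: Fpow_def)
      moreover have "nbhd p (insert i0 F) x \<subseteq> U n" using F(2) nbhd_antimono[of F "insert i0 F" p x] by blast
      ultimately show ?thesis by blast
    qed
    then obtain x F where xF: "\<And>n. F n \<in> Fpow (crd p)" "\<And>n. F n \<noteq> {}" "\<And>n. nbhd p (F n) (x n) \<subseteq> U n" by metis
    have "nbhd p (F m) (x m) \<inter> nbhd p (F n) (x n) = {}" if "m \<noteq> n" for m n
    proof -
      have "disjnt (U m) (U n)" using U that by (simp add: pairwise_def)
      then show ?thesis using xF(3)[of m] xF(3)[of n] unfolding disjnt_def by blast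
    qed
    then have "separated_family p x F" using xF(1) p(2) by (simp add: separated_family_def)
    then have "accumulates p x F" using p(5) xF(2) by blast
    then obtain A z where A: "\<And>n. A n \<in> Nwd_omega X" "\<And>n. A n \<subseteq> nbhd p (F n) (x n)" "z \<in> pts p"
      "\<And>V. openin X V \<Longrightarrow> z \<in> V \<Longrightarrow> infinite {n :: nat. A n \<inter> V \<noteq> {}}"
      using accumulates_imp_selection[OF p(1,3)] unfolding X_def by metis
    have "A n \<subseteq> U n" for n using A(2) xF(3) by blast
    then show "\<exists>A. (\<forall>n. A n \<in> Nwd_omega X \<and> A n \<subseteq> U n) \<and>
        (\<exists>x\<in>topspace X. \<forall>V. openin X V \<and> x \<in> V \<longrightarrow> infinite {n. A n \<inter> V \<noteq> {}})"
      using A(1,3,4) unfolding X_def by (intro exI[of _ A] conjI bexI[of _ z]) auto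
  qed
  moreover have "card_of (topspace X) =o cardSuc natLeq"
    using assms p(2) by (simp add: X_def CH_def)
  moreover have "weight_eq X (cardSuc natLeq)"
    using weight_cond_topology[OF assms p(1,2) _ i0] cd unfolding X_def by blast
  ultimately show ?thesis
    using crowded_cond_topology[OF p(1)] dim_le_0_cond_topology[of p]
      Hausdorff_cond_topology[OF consistentD(2)[OF p(1)]] cd
    unfolding X_def by blast
qed

end
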